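(* Let $X$ be a real Banach space, let $[a,b]=[a_1,b_1]\times[a_2,b_2]\subset\mathbb{R}^2$ with $-\infty<a_i<b_i<+\infty$ for $i=1,2$, and let $f\in\mathcal{S^{*}HK}[a,b]$ (so $f:[a,b]\to X$ has the property $\mathcal{S^*HK}$). Let $$Z_1=\{t_1\in[a_1,b_1]: f_{t_1}\notin\mathcal{S^{*}HK}[a_2,b_2]\},\qquad Z_2=\{t_2\in[a_2,b_2]: f_{t_2}\notin\mathcal{S^{*}HK}[a_1,b_1]\},$$ $Z=(Z_1\times[a_2,b_2])\cup([a_1,b_1]\times Z_2)$ and $f_0=f\cdot\mathbf{1}_{[a,b]\setminus Z}$. Then the following statements hold. (i) $f_0\in\mathcal{SHK}[a,b]$, and for each $(t_1,t_2)\in[a_1,b_1]\times[a_2,b_2]$ we have $(f_0)_{t_1}\in\mathcal{SHK}[a_2,b_2]$ and $(f_0)_{t_2}\in\mathcal{SHK}[a_1,b_1]$. (ii) The function $g(t_1)=(HK)\int_{[a_2,b_2]}(f_0)_{t_1}$, for all $t_1\in[a_1,b_1]$, is strongly Henstock-Kurzweil integrable on $[a_1,b_1]$ and $$(HK)\int_{[a_1,b_1]}\left((HK)\int_{[a_2,b_2]}(f_0)_{t_1}\right)=(HK)\int_{[a,b]}f.$$ (iii) The function $h(t_2)=(HK)\int_{[a_1,b_1]}(f_0)_{t_2}$, for all $t_2\in[a_2,b_2]$, is strongly Henstock-Kurzweil integrable on $[a_2,b_2]$ and $$(HK)\int_{[a_2,b_2]}\left((HK)\int_{[a_1,b_1]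}(f_0)_{t_2}\right)=(HK)\int_{[a,b]}f.$$
   Context: $X$ is a real Banach space with norm $\|\cdot\|$. Let $K$ be a compact non-degenerate interval in $\mathbb{R}^m$ with $m\in\{1,2\}$ (for $m=2$, a product $[a_1,b_1]\times[a_2,b_2]$ with $a_i<b_i$). $\mathbb{R}^2$ carries the maximum norm; $B(t,r)$ denotes the open ball with center $t$ and radius $r$ (for $m=1$ the open interval $(t-r,t+r)$). $|A|$ is the Lebesgue measure of $A$ and $A^o$ its interior. $\mathcal{I}_K$ is the family of all closed non-degenerate subintervals of $K$; $I,J\in\mathcal{I}_K$ are non-overlapping if $I^o\cap J^o=\emptyset$. An $\mathcal{HK}$-partition in $K$ is a finite collection $P$ of pairs $(t,I)$ with $I\in\mathcal{I}_K$ and $t\in I$ whose intervals are pairwise non-overlapping; it is an $\mathcal{HK}$-partition of $K$ if moreover $\bigcup_{(t,I)\in P}I=K$. A gauge on $K$ is a function $\delta:K\to(0,+\infty)$; $P$ is $\delta$-fine if $I\subset B(t,\delta(t))$ for every $(t,I)\in P$. A function $F:\mathcal{I}_K\to X$ is an additive interval function if $F(I\cup J)=F(I)+F(J)$ for any two non-overlapping $I,J\in\mathcal{I}_K$ with $I\cup J\in\mathcal{I}_K$. A function $f:K\to X$ is strongly Henstock-Kurzweil integrable on $K$ if there is an additive interval function $F:\mathcal{I}_K\to X$ such that for every $\varepsilon>0$ there is a gauge $\delta$ on $K$ with $\sum_{(t,I)\in P}\|f(t)|I|-F(I)\|<\varepsilon$ for every $\delta$-fine $\mathcal{HK}$-partition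 $P$ of $K$. $\mathcal{SHK}(K)$ (written $\mathcal{SHK}[a,b]$, $\mathcal{SHK}[a_i,b_i]$) is the set of all such $X$-valued functions on $K$. In this case $f$ is Henstock-Kurzweil integrable on $K$ and $(HK)\int_I f=F(I)$ for all $I\in\mathcal{I}_K$. A function $f:K\to X$ has the property $\mathcal{S^{*}HK}$ if for every $\varepsilon>0$ there is a gauge $\delta$ on $K$ such that $\sum_{(t,I)\in P}\sum_{(s,J)\in Q}\|f(t)-f(s)\|\,|I\cap J|<\varepsilon$ for each pair of $\delta$-fine $\mathcal{HK}$-partitions $P$ and $Q$ of $K$. $\mathcal{S^{*}HK}(K)$ is the set of all such $X$-valued functions on $K$; it is known that $\mathcal{S^{*}HK}(K)\subset\mathcal{SHK}(K)$, so $(HK)\int_K f$ is defined for $f\in\mathcal{S^{*}HK}(K)$. For $f:[a,b]\to X$, $t_1\in[a_1,b_1]$ and $t_2\in[a_2,b_2]$, the sections are $f_{t_1}:[a_2,b_2]\to X$, $f_{t_1}(s_2)=f(t_1,s_2)$, and $f_{t_2}:[a_1,b_1]\to X$, $f_{t_2}(s_1)=f(s_1,t_2)$ (subscript $t_1$ fixes the first variable, subscript $t_2$ fixes the second). $\mathbf{1}_A$ denotes the indicator function of $A$. *)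

theory Defs
  imports "HOL-Analysis.Analysis"
begin

text \<open>
  Functions on a compact interval \<open>K\<close> are represented by total functions; only their values
  on \<open>K\<close> matter. All notions are stated over an arbitrary Euclidean space; the
  cases \<open>m = 1\<close> and \<open>m = 2\<close> are the types \<^typ>\<open>real\<close> and \<^typ>\<open>real \<times> real\<close>. The Lebesgue measure
  is \<^term>\<open>measure lborel\<close>, and the Henstock-Kurzweil integral is \<^const>\<open>integral\<close>.
\<close>

definition subintervals :: "'a::euclidean_space set \<Rightarrow> 'a set set" where
  "subintervals K = {I. I \<subseteq> K \<and> (\<exists>c d. I = cbox c d) \<and> interior I \<noteq> {}}"

text \<open>
  Tagged divisions in the library may contain degenerate intervals, which are excluded here.
\<close>

definition hk_partition_of :: "('a::euclidean_space \<times> 'a set) set \<Rightarrow> 'a set \<Rightarrow> bool"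
    (infix \<open>hk'_partition'_of\<close> 50) where
  "P hk_partition_of K \<longleftrightarrow> P tagged_division_of K \<and> (\<forall>(t, I)\<in>P. I \<in> subintervals K)"

definition gauge_on :: "'a set \<Rightarrow> ('a \<Rightarrow> real) \<Rightarrow> bool" where
  "gauge_on K \<delta> \<longleftrightarrow> (\<forall>t\<in>K. 0 < \<delta> t)"

text \<open>\<^const>\<open>infnorm\<close> is the maximum norm; on \<^typ>\<open>real\<close> it is the absolute value.\<close>

definition max_ball :: "'a::euclidean_space \<Rightarrow> real \<Rightarrow> 'a set" where
  "max_ball t r = {x. infnorm (x - t) < r}"

definition delta_fine :: "('a::euclidean_space \<Rightarrow> real) \<Rightarrow> ('a \<times> 'a set) set \<Rightarrow> bool" where
  "delta_fine \<delta> P \<longleftrightarrow> (\<lambda>t. max_ball t (\<delta> t)) fine P"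

definition additive_on ::
    "'a::euclidean_space set \<Rightarrow> ('a set \<Rightarrow> 'x::real_normed_vector) \<Rightarrow> bool" where
  "additive_on K F \<longleftrightarrow>
     (\<forall>I\<in>subintervals K. \<forall>J\<in>subintervals K.
        interior I \<inter> interior J = {} \<and> I \<union> J \<in> subintervals K \<longrightarrow> F (I \<union> J) = F I + F J)"

definition SHK :: "'a::euclidean_space set \<Rightarrow> ('a \<Rightarrow> 'x::real_normed_vector) set" where
  "SHK K = {f. \<exists>F. additive_on K F \<and>
     (\<forall>\<epsilon>>0. \<exists>\<delta>. gauge_on K \<delta> \<and>
        (\<forall>P. P hk_partition_of K \<and> delta_fine \<delta> P \<longrightarrow>
           (\<Sum>(t, I)\<in>P. norm (measure lborel I *\<^sub>R f t - F I)) < \<epsilon>))}"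

definition Sstar_HK :: "'a::euclidean_space set \<Rightarrow> ('a \<Rightarrow> 'x::real_normed_vector) set" where
  "Sstar_HK K = {f. \<forall>\<epsilon>>0. \<exists>\<delta>. gauge_on K \<delta> \<and>
     (\<forall>P Q. P hk_partition_of K \<and> delta_fine \<delta> P \<and> Q hk_partition_of K \<and> delta_fine \<delta> Q \<longrightarrow>
        (\<Sum>(t, I)\<in>P. \<Sum>(s, J)\<in>Q. norm (f t - f s) * measure lborel (I \<inter> J)) < \<epsilon>)}"

end

theory Submission
  imports Defs
begin

text \<open>
  A tagged division \<open>P\<close> turns \<open>f\<close> into the step function with value \<open>f t\<close> on \<open>I\<close> for \<open>(t, I) \<in> P\<close>, and the
  double sum in the definition of \<^const>\<open>Sstar_HK\<close> is the \<open>L\<^sup>1\<close> distance of two such step functions.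
  The property therefore says that the step functions of \<open>f\<close> along fine divisions are Cauchy in
  \<open>L\<^sup>1\<close>; this is \<open>step_Cauchy_on\<close> below, stated with open gauges and with degenerate intervals
  admitted, which changes nothing because they carry no mass (\<open>Sstar_HK_iff_step_Cauchy_on\<close>).
  
  Riemann sums are integrals of step functions, so they are Cauchy and \<open>f\<close> is integrable. Comparing a
  fine division with a finer one that refines it interval by interval bounds the error of each
  term separately, which is strong integrability (\<open>step_Cauchy_on_imp_SHK\<close>). A change of \<open>f\<close> on a
  null set moves step functions by little in \<open>L\<^sup>1\<close> (\<open>step_Cauchy_on_spike\<close>).
  
  The passage to slices rests on product divisions: over each tag \<open>t\<close> of a division \<open>D\<close> of the first
  factor one erects a division \<open>Q t\<close> of the second factor. Since \<open>Q t\<close> has finitely many tags, a gauge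
  on the first factor can be chosen after \<open>Q\<close> so that the product is fine whenever \<open>D\<close> is
  (\<open>gauge_slices\<close>), and the \<open>L\<^sup>1\<close> distance of two products is an iterated sum over the factors.
  Two choices of \<open>Q\<close> give the result.
  
  \<^item> If the slice at \<open>t\<close> fails to be Cauchy at level \<open>e\<close>, erect over \<open>t\<close> two fine divisions whose step
  functions are at distance at least \<open>e\<close>; over all other tags use one division twice. The two
  products are close, so the intervals of \<open>D\<close> with such a tag have small total measure. Hence the
  exceptional set is null (\<open>negligible_non_step_Cauchy_slices\<close>).
  
  \<^item> If all slices are integrable, erect divisions whose Riemann sums approximate the slice
  integrals \<open>g t\<close>. The step functions of \<open>g\<close> then inherit closeness from those of \<open>f\<close>, so \<open>g\<close> has the
  same Cauchy property, and its integral is that of \<open>f\<close> (\<open>Fubini_step_Cauchy_on\<close>).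
  
  In the theorem \<open>Z\<close> is null by the first point, so \<open>f\<^sub>0\<close> is still Cauchy. Its slices are zero or
  differ from Cauchy slices of \<open>f\<close> on a null set, so all of them are Cauchy and the second point
  applies to \<open>f\<^sub>0\<close>. The other order of integration follows by exchanging the coordinates.
\<close>

hide_const (open) Polynomial.content

declare tagged_division_ofD [rule del]

section \<open>Distance of Riemann step functions\<close>

text \<open>
  For divisions of the same interval this is the \<open>L\<^sup>1\<close> distance between the step functions
  \<open>\<Sum>(t, I)\<in>P. u t \<cdot> 1\<^sub>I\<close> and \<open>\<Sum>(s, J)\<in>Q. v s \<cdot> 1\<^sub>J\<close>. Two functions are allowed because two different
  slices of one function will be compared.
\<close>

definition step_dist ::
    "('a::euclidean_space \<Rightarrow> 'x::real_normed_vector) \<Rightarrow> ('a \<times> 'a set) set \<Rightarrow>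
     ('a \<Rightarrow> 'x) \<Rightarrow> ('a \<times> 'a set) set \<Rightarrow> real" where
  "step_dist u P v Q = (\<Sum>(t, I)\<in>P. \<Sum>(s, J)\<in>Q. norm (u t - v s) * content (I \<inter> J))"

definition step_Cauchy_on ::
    "'a::euclidean_space set \<Rightarrow> ('a \<Rightarrow> 'x::real_normed_vector) \<Rightarrow> bool" where
  "step_Cauchy_on K f \<longleftrightarrow>
     (\<forall>\<epsilon>>0. \<exists>\<gamma>. gauge \<gamma> \<and>
        (\<forall>P Q. P tagged_division_of K \<and> \<gamma> fine P \<and> Q tagged_division_of K \<and> \<gamma> fine Q
           \<longrightarrow> step_dist f P f Q < \<epsilon>))"

lemma step_Cauchy_onE:
  assumes "step_Cauchy_on K f" and "0 < \<epsilon>"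
  obtains \<gamma> where "gauge \<gamma>"
    and "\<And>P Q. P tagged_division_of K \<Longrightarrow> \<gamma> fine P \<Longrightarrow> Q tagged_division_of K \<Longrightarrow> \<gamma> fine Q
           \<Longrightarrow> step_dist f P f Q < \<epsilon>"
  using assms unfolding step_Cauchy_on_def by meson

lemma content_Int_tagged_division:
  assumes P: "P tagged_division_of cbox a b" and J: "J = cbox c d" "J \<subseteq> cbox a b"
  shows "(\<Sum>(t, I)\<in>P. content (I \<inter> J)) = content J"
proof -
  let ?g = "\<lambda>x. if x \<in> J then 1 else 0 :: real"
  have has: "(?g has_integral content (I \<inter> J)) I" if "I = cbox x y" for I x y
  proof -
    have "((\<lambda>_. 1::real) has_integral content (J \<inter> I)) (J \<inter> I)"
      using has_integral_const[of "1::real"] that J by (auto simp: Int_interval)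
    then show ?thesis
      by (simp add: has_integral_restrict_Int Int_commute)
  qed
  have "content (cbox a b \<inter> J) = integral (cbox a b) ?g"
    by (rule integral_unique[symmetric], rule has[OF refl])
  also have "\<dots> = (\<Sum>(t, I)\<in>P. integral I ?g)"
    using has[OF refl, of a b] P by (intro integral_combine_tagged_division_topdown) auto
  also have "\<dots> = (\<Sum>(t, I)\<in>P. content (I \<inter> J))"
    using has tagged_division_ofD(4)[OF P]
    by (intro sum.cong refl) (clarify, rule integral_unique, blast)
  finally show ?thesis
    using J by (simp add: Int_absorb1)
qed

text \<open>
  The intersections \<open>I \<inter> J\<close> form a common refinement of both divisions, on which either Riemann sum
  can be computed.
\<close>

lemma riemann_sum_common_refinement:
  fixes u :: "'a::euclidean_space \<Rightarrow> 'x::real_normed_vector"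
  assumes P: "P tagged_division_of cbox a b" and Q: "Q tagged_division_of cbox a b"
  shows "(\<Sum>(t, I)\<in>P. \<Sum>(s, J)\<in>Q. content (I \<inter> J) *\<^sub>R u t) = (\<Sum>(t, I)\<in>P. content I *\<^sub>R u t)"
    and "(\<Sum>(t, I)\<in>P. \<Sum>(s, J)\<in>Q. content (I \<inter> J) *\<^sub>R u s) = (\<Sum>(s, J)\<in>Q. content J *\<^sub>R u s)"
proof -
  have split: "(\<Sum>(t, I)\<in>P. \<Sum>(s, J)\<in>Q. content (I \<inter> J) *\<^sub>R u t) = (\<Sum>(t, I)\<in>P. content I *\<^sub>R u t)"
    if P: "P tagged_division_of cbox a b" and Q: "Q tagged_division_of cbox a b"
    for P Q :: "('a \<times> 'a set) set"
  proof (intro sum.cong refl, clarify)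
    fix t I assume tI: "(t, I) \<in> P"
    then obtain x y where "I = cbox x y" "I \<subseteq> cbox a b"
      using tagged_division_ofD(3,4)[OF P] by metis
    then have "content I = (\<Sum>(s, J)\<in>Q. content (I \<inter> J))"
      using content_Int_tagged_division[OF Q] by (simp add: Int_commute)
    then show "(\<Sum>(s, J)\<in>Q. content (I \<inter> J) *\<^sub>R u t) = content I *\<^sub>R u t"
      by (simp add: scaleR_sum_left case_prod_unfold)
  qed
  show "(\<Sum>(t, I)\<in>P. \<Sum>(s, J)\<in>Q. content (I \<inter> J) *\<^sub>R u t) = (\<Sum>(t, I)\<in>P. content I *\<^sub>R u t)"
    by (rule split[OF P Q])
  have "(\<Sum>(t, I)\<in>P. \<Sum>(s, J)\<in>Q. content (I \<inter> J) *\<^sub>R u s) = (\<Sum>(s, J)\<in>Q. \<Sum>(t, I)\<in>P. content (J \<inter> I) *\<^sub>R u s)"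
    unfolding case_prod_unfold by (subst sum.swap) (simp add: Int_commute)
  also have "\<dots> = (\<Sum>(s, J)\<in>Q. content J *\<^sub>R u s)"
    by (rule split[OF Q P])
  finally show "(\<Sum>(t, I)\<in>P. \<Sum>(s, J)\<in>Q. content (I \<inter> J) *\<^sub>R u s) = (\<Sum>(s, J)\<in>Q. content J *\<^sub>R u s)" .
qed

text \<open>
  The norm of an integral is at most the \<open>L\<^sup>1\<close> norm of the integrand, here for the difference of two
  step functions.
\<close>

lemma riemann_sum_diff_le_step_dist:
  fixes u v :: "'a::euclidean_space \<Rightarrow> 'x::real_normed_vector"
  assumes P: "P tagged_division_of cbox a b" and Q: "Q tagged_division_of cbox a b"
  shows "norm ((\<Sum>(t, I)\<in>P. content I *\<^sub>R u t) - (\<Sum>(s, J)\<in>Q. content J *\<^sub>R v s))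
           \<le> step_dist u P v Q"
proof -
  have "(\<Sum>(t, I)\<in>P. content I *\<^sub>R u t) - (\<Sum>(s, J)\<in>Q. content J *\<^sub>R v s)
      = (\<Sum>(t, I)\<in>P. \<Sum>(s, J)\<in>Q. content (I \<inter> J) *\<^sub>R (u t - v s))"
    unfolding riemann_sum_common_refinement(1)[OF P Q, of u, symmetric]
      riemann_sum_common_refinement(2)[OF P Q, of v, symmetric]
    by (simp add: case_prod_unfold sum_subtractf scaleR_diff_right)
  also have "norm \<dots> \<le> step_dist u P v Q"
    unfolding step_dist_def
    by (intro sum_norm_le, clarify, intro sum_norm_le) (auto simp: mult.commute)
  finally show ?thesis .
qed

lemma step_Cauchy_on_imp_integrable:
  fixes f :: "'a::euclidean_space \<Rightarrow> 'x::banach"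
  assumes "step_Cauchy_on (cbox a b) f"
  shows "f integrable_on cbox a b"
  unfolding integrable_Cauchy
proof (intro allI impI)
  fix e :: real assume "0 < e"
  with assms obtain \<gamma> where \<gamma>: "gauge \<gamma>"
    "\<And>P Q. P tagged_division_of cbox a b \<Longrightarrow> \<gamma> fine P \<Longrightarrow> Q tagged_division_of cbox a b \<Longrightarrow> \<gamma> fine Q
       \<Longrightarrow> step_dist f P f Q < e"
    by (rule step_Cauchy_onE) blast
  then show "\<exists>\<gamma>. gauge \<gamma> \<and> (\<forall>P Q. P tagged_division_of cbox a b \<and> \<gamma> fine P \<and>
      Q tagged_division_of cbox a b \<and> \<gamma> fine Q \<longrightarrow>
      norm ((\<Sum>(x, K)\<in>P. content K *\<^sub>R f x) - (\<Sum>(x, K)\<in>Q. content K *\<^sub>R f x)) < e)"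
    by - (rule exI[of _ \<gamma>], intro conjI allI impI, assumption,
      elim conjE, rule le_less_trans[OF riemann_sum_diff_le_step_dist], assumption+)
qed

section \<open>Comparison with nondegenerate partitions and the maximum norm\<close>

lemma max_ball_open: "open (max_ball t r)"
proof -
  have "continuous_on UNIV (\<lambda>x. infnorm (x - t))"
    by (intro continuous_intros)
  then show ?thesis
    unfolding max_ball_def by (intro open_Collect_less) auto
qed

lemma gauge_on_refining_gauge:
  fixes \<gamma> :: "'a::euclidean_space \<Rightarrow> 'a set"
  assumes "gauge \<gamma>"
  obtains \<delta> where "gauge_on K \<delta>" and "\<And>P. delta_fine \<delta> P \<Longrightarrow> \<gamma> fine P"
proof -
  have "\<exists>r>0. max_ball t r \<subseteq> \<gamma> t" for t
  proof -
    obtain e where e: "e > 0" "ball t e \<subseteq> \<gamma> t"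
      using assms openE[of "\<gamma> t" t] by (auto simp: gauge_def)
    let ?c = "sqrt DIM('a)"
    have c: "?c > 0" by simp
    have "max_ball t (e / ?c) \<subseteq> ball t e"
    proof
      fix x assume "x \<in> max_ball t (e / ?c)"
      then have "?c * infnorm (x - t) < e"
        using c by (simp add: max_ball_def pos_less_divide_eq mult.commute)
      then show "x \<in> ball t e"
        using norm_le_infnorm[of "x - t"] by (simp add: dist_norm norm_minus_commute)
    qed
    then show ?thesis using e c by (intro exI[of _ "e / ?c"]) auto
  qed
  then obtain \<delta> where "\<And>t. 0 < \<delta> t \<and> max_ball t (\<delta> t) \<subseteq> \<gamma> t" by metis
  then show ?thesis
    by (intro that[of \<delta>]) (auto simp: gauge_on_def delta_fine_def fine_def, blast)
qed

text \<open>
  Degenerate intervals may be dropped because the remaining closed intervals still cover: what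
  they miss would be relatively open and null.
\<close>

lemma hk_partition_of_nondegenerate_part:
  assumes P: "P tagged_division_of cbox a b" and K: "interior (cbox a b) \<noteq> {}"
  shows "{(t, I)\<in>P. content I \<noteq> 0} hk_partition_of cbox a b" (is "?P hk_partition_of _")
proof -
  note PD = tagged_division_ofD[OF P]
  have "{I \<in> snd ` P. content I \<noteq> 0} division_of cbox a b"
    using K by (intro division_of_nontrivial division_of_tagged_division[OF P])
      (simp add: content_eq_0_interior)
  then have "\<Union>{I \<in> snd ` P. content I \<noteq> 0} = cbox a b" by blast
  moreover have "{I \<in> snd ` P. content I \<noteq> 0} = {I. \<exists>t. (t, I) \<in> ?P}" by force
  ultimately have UN: "\<Union>{I. \<exists>t. (t, I) \<in> ?P} = cbox a b" by simp
  have "?P tagged_division_of cbox a b"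
  proof (rule tagged_division_ofI[OF _ _ _ _ _ UN])
    show "finite ?P" using PD(1) by (rule finite_subset[rotated]) auto
    show "interior I \<inter> interior J = {}"
      if "(t, I) \<in> ?P" "(s, J) \<in> ?P" "(t, I) \<noteq> (s, J)" for t I s J
      using that by (intro PD(5)) auto
  qed (auto dest: PD(2) subsetD[OF PD(3)] PD(4))
  moreover have "I \<in> subintervals (cbox a b)" if "(t, I) \<in> ?P" for t I
  proof -
    obtain x y where xy: "I = cbox x y" "I \<subseteq> cbox a b" "content I \<noteq> 0"
      using \<open>(t, I) \<in> ?P\<close> PD by auto metis
    then show ?thesis
      unfolding subintervals_def by (auto simp: content_eq_0_interior)
  qed
  ultimately show ?thesis by (auto simp: hk_partition_of_def)
qed

text \<open>
  Both gauge notions refine each other since the maximum norm is equivalent to the Euclidean norm,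
  and intervals of content zero contribute nothing to \<^const>\<open>step_dist\<close>.
\<close>

lemma Sstar_HK_iff_step_Cauchy_on:
  fixes f :: "'a::euclidean_space \<Rightarrow> 'x::real_normed_vector"
  assumes K: "interior (cbox a b) \<noteq> {}"
  shows "f \<in> Sstar_HK (cbox a b) \<longleftrightarrow> step_Cauchy_on (cbox a b) f"
proof
  assume f: "f \<in> Sstar_HK (cbox a b)"
  show "step_Cauchy_on (cbox a b) f"
    unfolding step_Cauchy_on_def
  proof (intro allI impI)
    fix \<epsilon> :: real assume "0 < \<epsilon>"
    with f obtain \<delta> where \<delta>: "gauge_on (cbox a b) \<delta>"
      and lt: "\<And>P Q. P hk_partition_of cbox a b \<Longrightarrow> delta_fine \<delta> P \<Longrightarrow> Q hk_partition_of cbox a b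
        \<Longrightarrow> delta_fine \<delta> Q \<Longrightarrow> step_dist f P f Q < \<epsilon>"
      unfolding Sstar_HK_def step_dist_def by blast
    define \<gamma> where "\<gamma> t = (if t \<in> cbox a b then max_ball t (\<delta> t) else UNIV)" for t
    have "gauge \<gamma>"
      using \<delta> by (auto simp: gauge_def \<gamma>_def max_ball_open gauge_on_def)
        (simp add: max_ball_def infnorm_0)
    moreover have "step_dist f P f Q < \<epsilon>"
      if P: "P tagged_division_of cbox a b" "\<gamma> fine P"
        and Q: "Q tagged_division_of cbox a b" "\<gamma> fine Q" for P Q
    proof -
      define N where "N R = {(t, I)\<in>R. content I \<noteq> 0}" for R :: "('a \<times> 'a set) set"
      have fin: "finite P" "finite Q" using P(1) Q(1) by (blast intro: tagged_division_of_finite)+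
      have fine: "delta_fine \<delta> (N R)" if "R tagged_division_of cbox a b" "\<gamma> fine R" for R
        unfolding delta_fine_def fine_def
      proof clarify
        fix t I x assume "(t, I) \<in> N R" "x \<in> I"
        then have "(t, I) \<in> R" by (auto simp: N_def)
        then show "x \<in> max_ball t (\<delta> t)"
          using that tag_in_interval[OF that(1)] \<open>x \<in> I\<close> by (force simp: fine_def \<gamma>_def)
      qed
      have null: "content (I \<inter> J) = 0"
        if tI: "(t, I) \<in> P" and sJ: "(s, J) \<in> Q" and 0: "content I = 0 \<or> content J = 0" for t I s J
      proof -
        obtain x y x' y' where "I = cbox x y" "J = cbox x' y'"
          using tagged_division_ofD(4)[OF P(1) tI] tagged_division_ofD(4)[OF Q(1) sJ] by blast
        then show ?thesis
          using 0 content_0_subset[of x y "I \<inter> J"] content_0_subset[of x' y' "I \<inter> J"]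
          by auto
      qed
      have "step_dist f P f Q = step_dist f (N P) f (N Q)"
      proof -
        have "(\<Sum>(s, J)\<in>Q. norm (f t - f s) * content (I \<inter> J))
            = (\<Sum>(s, J)\<in>N Q. norm (f t - f s) * content (I \<inter> J))" if "(t, I) \<in> P" for t I
          using fin null[OF that] by (intro sum.mono_neutral_right) (auto simp: N_def)
        moreover have "(\<Sum>(s, J)\<in>N Q. norm (f t - f s) * content (I \<inter> J)) = 0"
          if "(t, I) \<in> P - N P" for t I
          using null that by (intro sum.neutral) (auto simp: N_def)
        ultimately show ?thesis
          unfolding step_dist_def using fin
          by (intro sum.mono_neutral_cong_right) (auto simp: N_def)
      qed
      also have "\<dots> < \<epsilon>"
        using P Q fine hk_partition_of_nondegenerate_part[OF _ K]
        by (intro lt) (auto simp: N_def)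
      finally show ?thesis .
    qed
    ultimately show "\<exists>\<gamma>. gauge \<gamma> \<and> (\<forall>P Q. P tagged_division_of cbox a b \<and> \<gamma> fine P \<and>
        Q tagged_division_of cbox a b \<and> \<gamma> fine Q \<longrightarrow> step_dist f P f Q < \<epsilon>)"
      by (intro exI[of _ \<gamma>]) simp
  qed
next
  assume f: "step_Cauchy_on (cbox a b) f"
  show "f \<in> Sstar_HK (cbox a b)"
    unfolding Sstar_HK_def
  proof (intro CollectI allI impI)
    fix \<epsilon> :: real assume "0 < \<epsilon>"
    with f obtain \<gamma> where \<gamma>: "gauge \<gamma>"
      and lt: "\<And>P Q. P tagged_division_of cbox a b \<Longrightarrow> \<gamma> fine P \<Longrightarrow> Q tagged_division_of cbox a b
        \<Longrightarrow> \<gamma> fine Q \<Longrightarrow> step_dist f P f Q < \<epsilon>"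
      by (rule step_Cauchy_onE) blast
    obtain \<delta> where "gauge_on (cbox a b) \<delta>" "\<And>P. delta_fine \<delta> P \<Longrightarrow> \<gamma> fine P"
      using gauge_on_refining_gauge[OF \<gamma>, of "cbox a b"] by blast
    then show "\<exists>\<delta>. gauge_on (cbox a b) \<delta> \<and> (\<forall>P Q. P hk_partition_of cbox a b \<and> delta_fine \<delta> P \<and>
        Q hk_partition_of cbox a b \<and> delta_fine \<delta> Q \<longrightarrow>
        (\<Sum>(t, I)\<in>P. \<Sum>(s, J)\<in>Q. norm (f t - f s) * content (I \<inter> J)) < \<epsilon>)"
      using lt unfolding hk_partition_of_def step_dist_def
      by (intro exI[of _ \<delta>]) simp
  qed
qed

section \<open>Strong integrability and null sets\<close>

lemma additive_on_integral:
  fixes f :: "'a::euclidean_space \<Rightarrow> 'x::banach"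
  assumes "f integrable_on cbox a b"
  shows "additive_on (cbox a b) (\<lambda>I. integral I f)"
  unfolding additive_on_def
proof (intro ballI impI, elim conjE)
  fix I J assume IJ: "I \<in> subintervals (cbox a b)" "J \<in> subintervals (cbox a b)"
    "interior I \<inter> interior J = {}"
  have int: "f integrable_on I" "f integrable_on J"
    using IJ(1,2) Henstock_Kurzweil_Integration.integrable_subinterval[OF assms] by (auto simp: subintervals_def)
  obtain x y x' y' where "I = cbox x y" "J = cbox x' y'"
    using IJ by (auto simp: subintervals_def)
  then obtain u v where uv: "I \<inter> J = cbox u v"
    by (simp add: Int_interval)
  then have "interior (cbox u v) = {}"
    using IJ(3) interior_Int by metis
  then have "negligible (I \<inter> J)"
    unfolding uv by (simp add: negligible_interval interior_cbox)
  then show "integral (I \<union> J) f = integral I f + integral J f"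
    using int by (intro integral_unique has_integral_Un) auto
qed

text \<open>
  The primitive is the indefinite integral. To bound the individual errors, replace each interval
  \<open>I\<close> of a fine partition \<open>P\<close> by a fine division of \<open>I\<close> whose Riemann sum is almost \<open>integral I f\<close>. The
  union \<open>U\<close> of these is a fine division of the whole interval, and the error at \<open>(t, I)\<close> is
  controlled by the part of \<open>step_dist f P f U\<close> that lives on \<open>I\<close>; these parts add up.
\<close>

lemma step_Cauchy_on_imp_SHK:
  fixes f :: "'a::euclidean_space \<Rightarrow> 'x::banach"
  assumes f: "step_Cauchy_on (cbox a b) f"
  shows "f \<in> SHK (cbox a b)"
proof -
  have int: "f integrable_on cbox a b"
    using f by (rule step_Cauchy_on_imp_integrable)
  have "\<exists>\<delta>. gauge_on (cbox a b) \<delta> \<and> (\<forall>P. P hk_partition_of cbox a b \<and> delta_fine \<delta> P \<longrightarrow>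
          (\<Sum>(t, I)\<in>P. norm (content I *\<^sub>R f t - integral I f)) < \<epsilon>)"
    if "0 < \<epsilon>" for \<epsilon>
  proof -
    obtain \<gamma> where \<gamma>: "gauge \<gamma>"
      and lt: "\<And>P Q. P tagged_division_of cbox a b \<Longrightarrow> \<gamma> fine P \<Longrightarrow> Q tagged_division_of cbox a b
        \<Longrightarrow> \<gamma> fine Q \<Longrightarrow> step_dist f P f Q < \<epsilon> / 2"
      using f half_gt_zero[OF \<open>0 < \<epsilon>\<close>] by (rule step_Cauchy_onE) blast
    obtain \<delta> where \<delta>: "gauge_on (cbox a b) \<delta>" "\<And>P. delta_fine \<delta> P \<Longrightarrow> \<gamma> fine P"
      using gauge_on_refining_gauge[OF \<gamma>, of "cbox a b"] by blast
    moreover have "(\<Sum>(t, I)\<in>P. norm (content I *\<^sub>R f t - integral I f)) < \<epsilon>"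
      if P: "P hk_partition_of cbox a b" "delta_fine \<delta> P" for P
    proof -
      have Pt: "P tagged_division_of cbox a b" and Pf: "\<gamma> fine P"
        using P \<delta> by (auto simp: hk_partition_of_def)
      note PD = tagged_division_ofD[OF Pt]
      define \<eta> where "\<eta> = \<epsilon> / (2 * (card P + 1))"
      have \<eta>: "0 < \<eta>" "card P * \<eta> \<le> \<epsilon> / 2"
        using \<open>0 < \<epsilon>\<close> by (auto simp: \<eta>_def field_simps)
      have "\<exists>q. q tagged_division_of I \<and> \<gamma> fine q \<and>
              norm ((\<Sum>(s, J)\<in>q. content J *\<^sub>R f s) - integral I f) < \<eta>"
        if "I \<in> snd ` P" for I
      proof -
        obtain x y where I: "I = cbox x y" "I \<subseteq> cbox a b" using \<open>I \<in> snd ` P\<close> PD(3,4) by (metis imageE prod.collapse)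
        then have "(f has_integral integral I f) (cbox x y)"
          using int Henstock_Kurzweil_Integration.integrable_subinterval[of f a b x y] by blast
        then obtain \<gamma>' where "gauge \<gamma>'" and \<gamma>': "\<And>q. q tagged_division_of cbox x y \<Longrightarrow> \<gamma>' fine q \<Longrightarrow>
            norm ((\<Sum>(s, J)\<in>q. content J *\<^sub>R f s) - integral I f) < \<eta>"
          using \<eta>(1) by (rule has_integralD) blast
        then obtain q where "q tagged_division_of cbox x y" "(\<lambda>x. \<gamma> x \<inter> \<gamma>' x) fine q"
          by (blast intro: fine_division_exists[OF gauge_Int[OF \<gamma>]])
        then show ?thesis using \<gamma>' I(1) by (auto simp: fine_Int)
      qed
      then obtain q where q: "\<And>I. I \<in> snd ` P \<Longrightarrow> q I tagged_division_of I"
        "\<And>I. I \<in> snd ` P \<Longrightarrow> \<gamma> fine q I"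
        "\<And>I. I \<in> snd ` P \<Longrightarrow> norm ((\<Sum>(s, J)\<in>q I. content J *\<^sub>R f s) - integral I f) < \<eta>"
        by metis
      define U where "U = \<Union>(q ` snd ` P)"
      have U: "U tagged_division_of cbox a b"
      proof -
        have "\<Union>(q ` snd ` P) tagged_division_of \<Union>(snd ` P)"
          using PD(1,5) q(1) by (intro tagged_division_Union) (force, blast, fastforce)
        moreover have "\<Union>(snd ` P) = cbox a b" using PD(6) by force
        ultimately show ?thesis by (simp add: U_def)
      qed
      have Uf: "\<gamma> fine U" unfolding U_def using q(2) by (intro fine_Union) auto
      have "norm (content I *\<^sub>R f t - integral I f) \<le> \<eta> + (\<Sum>(s, J)\<in>U. norm (f t - f s) * content (I \<inter> J))"
        if tI: "(t, I) \<in> P" for t I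
      proof -
        have I: "I \<in> snd ` P" using tI by force
        obtain x y where xy: "I = cbox x y" using PD(4) tI by blast
        have "norm (content I *\<^sub>R f t - (\<Sum>(s, J)\<in>q I. content J *\<^sub>R f s)) \<le> step_dist f {(t, I)} f (q I)"
          using riemann_sum_diff_le_step_dist[of "{(t, I)}" x y "q I" f f]
            tagged_division_of_self[of t x y] q(1)[OF I] PD(2)[OF tI] by (simp add: xy)
        also have "\<dots> \<le> (\<Sum>(s, J)\<in>U. norm (f t - f s) * content (I \<inter> J))"
          using I U unfolding step_dist_def
          by (auto simp: U_def dest: tagged_division_of_finite intro!: sum_mono2)
        finally show ?thesis
          using q(3)[OF I]
            norm_triangle_ineq[of "content I *\<^sub>R f t - (\<Sum>(s, J)\<in>q I. content J *\<^sub>R f s)"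
              "(\<Sum>(s, J)\<in>q I. content J *\<^sub>R f s) - integral I f"] by simp
      qed
      then have "(\<Sum>(t, I)\<in>P. norm (content I *\<^sub>R f t - integral I f))
          \<le> (\<Sum>(t, I)\<in>P. \<eta> + (\<Sum>(s, J)\<in>U. norm (f t - f s) * content (I \<inter> J)))"
        by (intro sum_mono) auto
      also have "\<dots> = card P * \<eta> + step_dist f P f U"
        by (simp add: step_dist_def case_prod_unfold sum.distrib)
      also have "\<dots> < \<epsilon>"
        using lt[OF Pt Pf U Uf] \<eta>(2) by linarith
      finally show ?thesis .
    qed
    ultimately show ?thesis by blast
  qed
  then show ?thesis
    unfolding SHK_def using additive_on_integral[OF int] by blast
qed

text \<open>
  The distance changes by at most the Riemann sums of \<open>norm (g - f)\<close> along the two divisions. These are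
  small for fine divisions, because this function vanishes off a null set and so has integral zero.
\<close>

lemma step_Cauchy_on_spike:
  fixes f g :: "'a::euclidean_space \<Rightarrow> 'x::real_normed_vector"
  assumes f: "step_Cauchy_on (cbox a b) f" and N: "negligible N"
    and eq: "\<And>x. x \<in> cbox a b - N \<Longrightarrow> g x = f x"
  shows "step_Cauchy_on (cbox a b) g"
  unfolding step_Cauchy_on_def
proof (intro allI impI)
  fix \<epsilon> :: real assume "0 < \<epsilon>"
  then have \<epsilon>3: "0 < \<epsilon> / 3" by simp
  define h where "h x = norm (g x - f x)" for x
  obtain \<gamma>1 where \<gamma>1: "gauge \<gamma>1"
    and f1: "\<And>P Q. P tagged_division_of cbox a b \<Longrightarrow> \<gamma>1 fine P \<Longrightarrow> Q tagged_division_of cbox a b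
      \<Longrightarrow> \<gamma>1 fine Q \<Longrightarrow> step_dist f P f Q < \<epsilon> / 3"
    using f \<epsilon>3 by (rule step_Cauchy_onE) blast
  have "(h has_integral 0) (cbox a b)"
    using N by (rule has_integral_negligible) (simp add: h_def eq)
  then obtain \<gamma>2 where \<gamma>2: "gauge \<gamma>2"
    and h: "\<And>P. P tagged_division_of cbox a b \<Longrightarrow> \<gamma>2 fine P
      \<Longrightarrow> norm ((\<Sum>(t, I)\<in>P. content I *\<^sub>R h t) - 0) < \<epsilon> / 3"
    using \<epsilon>3 by (rule has_integralD) blast
  have "step_dist g P g Q < \<epsilon>"
    if P: "P tagged_division_of cbox a b" "(\<lambda>x. \<gamma>1 x \<inter> \<gamma>2 x) fine P"
      and Q: "Q tagged_division_of cbox a b" "(\<lambda>x. \<gamma>1 x \<inter> \<gamma>2 x) fine Q" for P Q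
  proof -
    note hP = riemann_sum_common_refinement(1)[OF P(1) Q(1), of h, unfolded real_scaleR_def]
    note hQ = riemann_sum_common_refinement(2)[OF P(1) Q(1), of h, unfolded real_scaleR_def]
    have "step_dist g P g Q \<le> (\<Sum>(t, I)\<in>P. \<Sum>(s, J)\<in>Q.
        norm (f t - f s) * content (I \<inter> J) + content (I \<inter> J) * h t + content (I \<inter> J) * h s)"
      unfolding step_dist_def
    proof (intro sum_mono, clarify, intro sum_mono, clarify)
      fix t s and I J :: "'a set"
      have "norm (g t - g s) \<le> norm (f t - f s) + h t + h s"
        using norm_triangle_ineq4[of "f t - f s + (g t - f t)" "g s - f s"]
          norm_triangle_ineq[of "f t - f s" "g t - f t"] by (simp add: h_def)
      then have "norm (g t - g s) * content (I \<inter> J) \<le> (norm (f t - f s) + h t + h s) * content (I \<inter> J)"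
        by (rule mult_right_mono) simp
      then show "norm (g t - g s) * content (I \<inter> J)
          \<le> norm (f t - f s) * content (I \<inter> J) + content (I \<inter> J) * h t + content (I \<inter> J) * h s"
        by (simp add: algebra_simps)
    qed
    also have "\<dots> = step_dist f P f Q + (\<Sum>(t, I)\<in>P. content I * h t) + (\<Sum>(s, J)\<in>Q. content J * h s)"
      unfolding hP[symmetric] hQ[symmetric] step_dist_def
      by (simp add: case_prod_unfold sum.distrib)
    also have "\<dots> < \<epsilon>"
      using f1[OF P(1) _ Q(1)] h[OF P(1)] h[OF Q(1)] P(2) Q(2) by (simp add: fine_Int)
    finally show ?thesis .
  qed
  then show "\<exists>\<gamma>. gauge \<gamma> \<and> (\<forall>P Q. P tagged_division_of cbox a b \<and> \<gamma> fine P \<and>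
      Q tagged_division_of cbox a b \<and> \<gamma> fine Q \<longrightarrow> step_dist g P g Q < \<epsilon>)"
    by (intro exI[of _ "\<lambda>x. \<gamma>1 x \<inter> \<gamma>2 x"]) (simp add: gauge_Int[OF \<gamma>1 \<gamma>2])
qed

section \<open>Product divisions\<close>

definition product_division ::
    "('a \<times> 'a set) set \<Rightarrow> ('a \<Rightarrow> ('b \<times> 'b set) set) \<Rightarrow> (('a \<times> 'b) \<times> ('a \<times> 'b) set) set" where
  "product_division D Q = (\<lambda>((t, I), (s, J)). ((t, s), I \<times> J)) ` (SIGMA d:D. Q (fst d))"

text \<open>
  An interval that contains its tag is nonempty, so its two factors can be read off from the
  product; hence no term is lost when the product division is formed as an image.
\<close>

lemma sum_product_division:
  assumes D: "D tagged_division_of K" and Q: "\<And>t. Q t tagged_division_of L"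
  shows "(\<Sum>(z, R)\<in>product_division D Q. \<phi> z R) = (\<Sum>(t, I)\<in>D. \<Sum>(s, J)\<in>Q t. \<phi> (t, s) (I \<times> J))"
proof -
  have "inj_on (\<lambda>((t, I), (s, J)). ((t, s), I \<times> J)) (SIGMA d:D. Q (fst d))"
  proof (rule inj_onI, clarsimp)
    fix t I s J I' J'
    assume "(t, I) \<in> D" "(s, J) \<in> Q t" "I \<times> J = I' \<times> J'"
    then have "t \<in> I" "s \<in> J" "I \<times> J = I' \<times> J'"
      using tagged_division_ofD(2)[OF D] tagged_division_ofD(2)[OF Q] by auto
    then show "I = I' \<and> J = J'"
      by (auto simp: times_eq_iff)
  qed
  then have "(\<Sum>(z, R)\<in>product_division D Q. \<phi> z R)
      = (\<Sum>((t, I), (s, J))\<in>(SIGMA d:D. Q (fst d)). \<phi> (t, s) (I \<times> J))"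
    unfolding product_division_def by (simp add: sum.reindex case_prod_unfold)
  also have "\<dots> = (\<Sum>(t, I)\<in>D. \<Sum>(s, J)\<in>Q t. \<phi> (t, s) (I \<times> J))"
    using tagged_division_of_finite[OF D] tagged_division_of_finite[OF Q]
    by (subst sum.Sigma[symmetric]) (auto simp: case_prod_unfold)
  finally show ?thesis .
qed

lemma product_division_tagged_division_of:
  fixes a b :: "'a::euclidean_space" and c d :: "'b::euclidean_space"
  assumes D: "D tagged_division_of cbox a b" and Q: "\<And>t. Q t tagged_division_of cbox c d"
  shows "product_division D Q tagged_division_of cbox (a, c) (b, d)"
proof (rule tagged_division_ofI)
  note DD = tagged_division_ofD[OF D] and QD = tagged_division_ofD[OF Q]
  have mem: "\<exists>t s I J. z = (t, s) \<and> R = I \<times> J \<and> (t, I) \<in> D \<and> (s, J) \<in> Q t"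
    if "(z, R) \<in> product_division D Q" for z R
    using that by (clarsimp simp: product_division_def) blast
  show "finite (product_division D Q)"
    unfolding product_division_def using DD(1) QD(1) by (intro finite_imageI finite_SigmaI) auto
  show "z \<in> R" if "(z, R) \<in> product_division D Q" for z R
    using mem[OF that] DD(2) QD(2) by blast
  show "R \<subseteq> cbox (a, c) (b, d)" if "(z, R) \<in> product_division D Q" for z R
    unfolding cbox_Pair_eq using mem[OF that] DD(3) QD(3) by blast
  show "\<exists>x y. R = cbox x y" if "(z, R) \<in> product_division D Q" for z R
  proof -
    obtain t s I J where R: "R = I \<times> J" "(t, I) \<in> D" "(s, J) \<in> Q t"
      using mem[OF \<open>(z, R) \<in> _\<close>] by blast
    obtain x y x' y' where "I = cbox x y" "J = cbox x' y'"
      using DD(4)[OF R(2)] QD(4)[OF R(3)] by blast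
    with R(1) have "R = cbox (x, x') (y, y')" by (simp add: cbox_Pair_eq)
    then show ?thesis by blast
  qed
  show "interior R1 \<inter> interior R2 = {}"
    if z: "(z1, R1) \<in> product_division D Q" "(z2, R2) \<in> product_division D Q" "(z1, R1) \<noteq> (z2, R2)"
    for z1 R1 z2 R2
  proof -
    obtain t1 s1 I1 J1 where 1: "z1 = (t1, s1)" "R1 = I1 \<times> J1" "(t1, I1) \<in> D" "(s1, J1) \<in> Q t1"
      using mem[OF z(1)] by blast
    obtain t2 s2 I2 J2 where 2: "z2 = (t2, s2)" "R2 = I2 \<times> J2" "(t2, I2) \<in> D" "(s2, J2) \<in> Q t2"
      using mem[OF z(2)] by blast
    have "interior I1 \<inter> interior I2 = {} \<or> interior J1 \<inter> interior J2 = {}"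
    proof (cases "(t1, I1) = (t2, I2)")
      case True
      then have "(s1, J1) \<noteq> (s2, J2)" "(s2, J2) \<in> Q t1" using 1 2 z(3) by auto
      then show ?thesis using QD(5) 1 by blast
    next
      case False
      then show ?thesis using DD(5) 1 2 by blast
    qed
    then show ?thesis
      unfolding 1 2 interior_Times by blast
  qed
  show "\<Union>{R. \<exists>z. (z, R) \<in> product_division D Q} = cbox (a, c) (b, d)"
  proof (intro equalityI subsetI)
    fix w assume "w \<in> \<Union>{R. \<exists>z. (z, R) \<in> product_division D Q}"
    then show "w \<in> cbox (a, c) (b, d)"
      unfolding cbox_Pair_eq using mem DD(3) QD(3) by blast
  next
    fix w assume "w \<in> cbox (a, c) (b, d)"
    then obtain u v where w: "w = (u, v)" "u \<in> cbox a b" "v \<in> cbox c d"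
      by (auto simp: cbox_Pair_eq)
    obtain t I where I: "(t, I) \<in> D" "u \<in> I" using DD(6) w(2) by blast
    obtain s J where J: "(s, J) \<in> Q t" "v \<in> J" using QD(6)[of t] w(3) by blast
    have "((t, s), I \<times> J) \<in> product_division D Q"
      using I J by (force simp: product_division_def)
    then show "w \<in> \<Union>{R. \<exists>z. (z, R) \<in> product_division D Q}"
      using w(1) I J by blast
  qed
qed

text \<open>
  The order of the choices matters: \<open>\<beta>\<close>, which governs the divisions of the second factor, depends
  on \<open>\<gamma>\<close> alone, whereas \<open>\<alpha>\<close> on the first factor is found after the divisions \<open>Q t\<close>. At \<open>t\<close> it has to
  meet one condition for each tag of \<open>Q t\<close>, and these are finitely many.
\<close>

lemma gauge_slices:
  fixes \<gamma> :: "'a::euclidean_space \<times> 'b::euclidean_space \<Rightarrow> ('a \<times> 'b) set"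
  assumes \<gamma>: "gauge \<gamma>"
  shows "\<exists>\<beta>. (\<forall>t. gauge (\<beta> t)) \<and>
           (\<forall>Q. (\<forall>t. finite (Q t)) \<longrightarrow> (\<forall>t. \<beta> t fine Q t) \<longrightarrow>
              (\<exists>\<alpha>. gauge \<alpha> \<and> (\<forall>D. \<alpha> fine D \<longrightarrow> \<gamma> fine product_division D Q)))"
proof -
  have "\<exists>A B. open A \<and> open B \<and> t \<in> A \<and> s \<in> B \<and> A \<times> B \<subseteq> \<gamma> (t, s)" for t s
    using open_prod_elim[of "\<gamma> (t, s)" "(t, s)"] gaugeD[OF \<gamma>, of "(t, s)"]
    by (metis mem_Sigma_iff)
  then obtain A B where AB: "\<And>t s. open (A t s)" "\<And>t s. open (B t s)" "\<And>t s. t \<in> A t s"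
      "\<And>t s. s \<in> B t s" "\<And>t s. A t s \<times> B t s \<subseteq> \<gamma> (t, s)"
    by metis
  show ?thesis
  proof (intro exI[of _ B] conjI allI impI)
    show "gauge (B t)" for t
      using AB by (simp add: gauge_def)
    fix Q :: "'a \<Rightarrow> ('b \<times> 'b set) set"
    assume fin: "\<forall>t. finite (Q t)" and fine: "\<forall>t. B t fine Q t"
    let ?\<alpha> = "\<lambda>t. \<Inter>(s, J)\<in>Q t. A t s"
    have "gauge ?\<alpha>"
      using AB fin by (auto simp: gauge_def intro!: open_INT)
    moreover have "\<gamma> fine product_division D Q" if "?\<alpha> fine D" for D
    proof (rule fineI)
      fix z R assume "(z, R) \<in> product_division D Q"
      then obtain t s I J where *: "z = (t, s)" "R = I \<times> J" "(t, I) \<in> D" "(s, J) \<in> Q t"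
        by (auto simp: product_division_def)
      then have "I \<subseteq> A t s" "J \<subseteq> B t s"
        using fineD[OF that *(3)] fineD[OF spec[OF fine] *(4)] by auto
      then show "R \<subseteq> \<gamma> z" using AB(5)[of t s] * by blast
    qed
    ultimately show "\<exists>\<alpha>. gauge \<alpha> \<and> (\<forall>D. \<alpha> fine D \<longrightarrow> \<gamma> fine product_division D Q)" by blast
  qed
qed

text \<open>
  This is Tonelli's theorem for step functions: content is multiplicative on products, so the
  distance is the integral over the first factor of the distances between the slices.
\<close>

lemma step_dist_product_division:
  fixes f :: "'a::euclidean_space \<times> 'b::euclidean_space \<Rightarrow> 'x::real_normed_vector"
  assumes D: "D tagged_division_of cbox a b" and P: "\<And>t. P t tagged_division_of cbox c d"
    and D': "D' tagged_division_of cbox a b" and Q: "\<And>t. Q t tagged_division_of cbox c d"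
  shows "step_dist f (product_division D P) f (product_division D' Q)
    = (\<Sum>(t, I)\<in>D. \<Sum>(t', I')\<in>D'.
         content (I \<inter> I') * step_dist (\<lambda>s. f (t, s)) (P t) (\<lambda>s. f (t', s)) (Q t'))"
proof -
  have "step_dist f (product_division D P) f (product_division D' Q)
    = (\<Sum>(t, I)\<in>D. \<Sum>(s, J)\<in>P t. \<Sum>(t', I')\<in>D'. \<Sum>(s', J')\<in>Q t'.
         norm (f (t, s) - f (t', s')) * content (I \<times> J \<inter> I' \<times> J'))"
    unfolding step_dist_def by (simp only: sum_product_division[OF D P] sum_product_division[OF D' Q])
  also have "\<dots> = (\<Sum>(t, I)\<in>D. \<Sum>(t', I')\<in>D'. \<Sum>(s, J)\<in>P t. \<Sum>(s', J')\<in>Q t'.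
         norm (f (t, s) - f (t', s')) * content (I \<times> J \<inter> I' \<times> J'))"
    unfolding case_prod_unfold by (intro sum.cong refl sum.swap)
  also have "\<dots> = (\<Sum>(t, I)\<in>D. \<Sum>(t', I')\<in>D'.
         content (I \<inter> I') * step_dist (\<lambda>s. f (t, s)) (P t) (\<lambda>s. f (t', s)) (Q t'))"
  proof (intro sum.cong refl, clarify, intro sum.cong refl, clarify)
    fix t I t' I' assume I: "(t, I) \<in> D" "(t', I') \<in> D'"
    have "content (I \<times> J \<inter> I' \<times> J') = content (I \<inter> I') * content (J \<inter> J')"
      if J: "(s, J) \<in> P t" "(s', J') \<in> Q t'" for s J s' J'
    proof -
      obtain x y x' y' where "I = cbox x y" "I' = cbox x' y'"
        using tagged_division_ofD(4)[OF D I(1)] tagged_division_ofD(4)[OF D' I(2)] by blast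
      then obtain u v where "I \<inter> I' = cbox u v" by (simp add: Int_interval)
      moreover obtain x y x' y' where "J = cbox x y" "J' = cbox x' y'"
        using tagged_division_ofD(4)[OF P J(1)] tagged_division_ofD(4)[OF Q J(2)] by blast
      then obtain w z where "J \<inter> J' = cbox w z" by (simp add: Int_interval)
      ultimately show ?thesis
        by (simp add: Times_Int_Times content_Pair flip: cbox_Pair_eq)
    qed
    then show "(\<Sum>(s, J)\<in>P t. \<Sum>(s', J')\<in>Q t'.
         norm (f (t, s) - f (t', s')) * content (I \<times> J \<inter> I' \<times> J'))
       = content (I \<inter> I') * step_dist (\<lambda>s. f (t, s)) (P t) (\<lambda>s. f (t', s)) (Q t')"
      unfolding step_dist_def sum_distrib_left
      by (intro sum.cong refl, clarify, unfold sum_distrib_left, intro sum.cong refl) auto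
  qed
  finally show ?thesis .
qed

section \<open>Almost all slices are Cauchy\<close>

lemma step_dist_nonneg: "0 \<le> step_dist u P v Q"
  unfolding step_dist_def by (intro sum_nonneg) (auto intro!: sum_nonneg)

text \<open>
  Erect over each tag in the exceptional set two divisions at distance at least \<open>e\<close>. In the distance of
  the two products, the diagonal terms alone contribute \<open>e\<close> times the Riemann sum of the
  indicator of the exceptional set, so this sum is less than any prescribed \<open>\<epsilon>\<close>.
\<close>

lemma negligible_slices_step_dist_ge:
  fixes f :: "'a::euclidean_space \<times> 'b::euclidean_space \<Rightarrow> 'x::real_normed_vector"
  assumes f: "step_Cauchy_on (cbox (a, c) (b, d)) f" and "0 < e"
  shows "negligible {t \<in> cbox a b. \<forall>\<beta>. gauge \<beta> \<longrightarrow>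
           (\<exists>P Q. P tagged_division_of cbox c d \<and> \<beta> fine P \<and> Q tagged_division_of cbox c d \<and> \<beta> fine Q \<and>
              e \<le> step_dist (\<lambda>s. f (t, s)) P (\<lambda>s. f (t, s)) Q)}" (is "negligible ?E")
proof -
  define E where "E = ?E"
  have "(indicat_real E has_integral 0) (cbox a b)"
    unfolding has_integral
  proof (intro allI impI)
    fix \<epsilon> :: real assume "0 < \<epsilon>"
    \<comment> \<open>The factor \<open>e\<close> is cancelled at the end against the lower bound for the diagonal terms.\<close>
    then have "0 < e * \<epsilon>" using \<open>0 < e\<close> by simp
    with f obtain \<gamma> where \<gamma>: "gauge \<gamma>"
      and lt: "\<And>P Q. P tagged_division_of cbox (a, c) (b, d) \<Longrightarrow> \<gamma> fine P \<Longrightarrow>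
        Q tagged_division_of cbox (a, c) (b, d) \<Longrightarrow> \<gamma> fine Q \<Longrightarrow> step_dist f P f Q < e * \<epsilon>"
      by (rule step_Cauchy_onE) blast
    obtain \<beta> where \<beta>: "\<And>t. gauge (\<beta> t)"
      and \<alpha>: "\<And>Q. (\<And>t. finite (Q t)) \<Longrightarrow> (\<And>t. \<beta> t fine Q t) \<Longrightarrow>
           \<exists>\<alpha>. gauge \<alpha> \<and> (\<forall>D. \<alpha> fine D \<longrightarrow> \<gamma> fine product_division D Q)"
      using gauge_slices[OF \<gamma>] by auto
    define bad where "bad t P Q \<longleftrightarrow>
        P tagged_division_of cbox c d \<and> \<beta> t fine P \<and> Q tagged_division_of cbox c d \<and> \<beta> t fine Q \<and>
        (t \<in> E \<longrightarrow> e \<le> step_dist (\<lambda>s. f (t, s)) P (\<lambda>s. f (t, s)) Q)" for t P Q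
    have "\<exists>P Q. bad t P Q" for t
    proof (cases "t \<in> E")
      case True
      then show ?thesis unfolding bad_def E_def using \<beta>[of t] by simp
    next
      case False
      obtain P where "P tagged_division_of cbox c d" "\<beta> t fine P"
        by (rule fine_division_exists[OF \<beta>])
      with False show ?thesis unfolding bad_def by blast
    qed
    then obtain P Q where "\<And>t. bad t (P t) (Q t)"
      by metis
    then have P: "\<And>t. P t tagged_division_of cbox c d" "\<And>t. \<beta> t fine P t"
      and Q: "\<And>t. Q t tagged_division_of cbox c d" "\<And>t. \<beta> t fine Q t"
      and ge: "\<And>t. t \<in> E \<Longrightarrow> e \<le> step_dist (\<lambda>s. f (t, s)) (P t) (\<lambda>s. f (t, s)) (Q t)"
      unfolding bad_def by auto
    obtain \<alpha>P where \<alpha>P: "gauge \<alpha>P" "\<And>D. \<alpha>P fine D \<Longrightarrow> \<gamma> fine product_division D P"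
      using \<alpha>[OF tagged_division_of_finite[OF P(1)] P(2)] by auto
    obtain \<alpha>Q where \<alpha>Q: "gauge \<alpha>Q" "\<And>D. \<alpha>Q fine D \<Longrightarrow> \<gamma> fine product_division D Q"
      using \<alpha>[OF tagged_division_of_finite[OF Q(1)] Q(2)] by auto
    have "norm ((\<Sum>(t, I)\<in>D. content I *\<^sub>R indicat_real E t) - 0) < \<epsilon>"
      if D: "D tagged_division_of cbox a b" "(\<lambda>x. \<alpha>P x \<inter> \<alpha>Q x) fine D" for D
    proof -
      let ?s = "\<lambda>t t'. step_dist (\<lambda>s. f (t, s)) (P t) (\<lambda>s. f (t', s)) (Q t')"
      have "e * (\<Sum>(t, I)\<in>D. content I *\<^sub>R indicat_real E t) = (\<Sum>(t, I)\<in>D. content I * (e * indicat_real E t))"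
        by (simp add: sum_distrib_left case_prod_unfold mult_ac)
      also have "\<dots> \<le> (\<Sum>(t, I)\<in>D. content (I \<inter> I) * ?s t t)"
        using ge by (intro sum_mono) (auto simp: indicator_def step_dist_nonneg intro!: mult_left_mono)
      \<comment> \<open>Only the diagonal is kept; the other terms are nonnegative.\<close>
      also have "\<dots> \<le> (\<Sum>(t, I)\<in>D. \<Sum>(t', I')\<in>D. content (I \<inter> I') * ?s t t')"
      proof (intro sum_mono, clarify)
        fix t I assume "(t, I) \<in> D"
        then show "content (I \<inter> I) * ?s t t \<le> (\<Sum>(t', I')\<in>D. content (I \<inter> I') * ?s t t')"
          using member_le_sum[of "(t, I)" D "\<lambda>(t', I'). content (I \<inter> I') * ?s t t'"]
            tagged_division_of_finite[OF D(1)] by (auto simp: step_dist_nonneg)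
      qed
      also have "\<dots> = step_dist f (product_division D P) f (product_division D Q)"
        by (rule step_dist_product_division[OF D(1) P(1) D(1) Q(1), symmetric])
      also have "\<dots> < e * \<epsilon>"
        using D(2) \<alpha>P(2) \<alpha>Q(2) by (intro lt product_division_tagged_division_of D(1) P(1) Q(1)) (auto simp: fine_Int)
      finally have "(\<Sum>(t, I)\<in>D. content I *\<^sub>R indicat_real E t) < \<epsilon>"
        using \<open>0 < e\<close> by simp
      moreover have "0 \<le> (\<Sum>(t, I)\<in>D. content I *\<^sub>R indicat_real E t)"
        by (intro sum_nonneg) auto
      ultimately show ?thesis by simp
    qed
    then show "\<exists>\<alpha>. gauge \<alpha> \<and> (\<forall>D. D tagged_division_of cbox a b \<and> \<alpha> fine D \<longrightarrow>
        norm ((\<Sum>(t, I)\<in>D. content I *\<^sub>R indicat_real E t) - 0) < \<epsilon>)"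
      by (intro exI[of _ "\<lambda>x. \<alpha>P x \<inter> \<alpha>Q x"]) (simp add: gauge_Int[OF \<alpha>P(1) \<alpha>Q(1)])
  qed
  then have "(indicat_real E has_integral 0) UNIV"
    by (rule has_integral_on_superset) (auto simp: E_def)
  then show ?thesis
    by (simp add: negligible_UNIV E_def)
qed

lemma negligible_non_step_Cauchy_slices:
  fixes f :: "'a::euclidean_space \<times> 'b::euclidean_space \<Rightarrow> 'x::real_normed_vector"
  assumes f: "step_Cauchy_on (cbox (a, c) (b, d)) f"
  shows "negligible {t \<in> cbox a b. \<not> step_Cauchy_on (cbox c d) (\<lambda>s. f (t, s))}"
proof -
  define E where "E e = {t \<in> cbox a b. \<forall>\<beta>. gauge \<beta> \<longrightarrow>
      (\<exists>P Q. P tagged_division_of cbox c d \<and> \<beta> fine P \<and> Q tagged_division_of cbox c d \<and> \<beta> fine Q \<and>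
         e \<le> step_dist (\<lambda>s. f (t, s)) P (\<lambda>s. f (t, s)) Q)}" for e
  have "negligible (\<Union>n. E (inverse (real (Suc n))))"
    unfolding E_def by (intro negligible_Union_nat negligible_slices_step_dist_ge[OF f]) simp
  moreover have "{t \<in> cbox a b. \<not> step_Cauchy_on (cbox c d) (\<lambda>s. f (t, s))} \<subseteq> (\<Union>n. E (inverse (real (Suc n))))"
  proof clarify
    fix t assume t: "t \<in> cbox a b" "\<not> step_Cauchy_on (cbox c d) (\<lambda>s. f (t, s))"
    then obtain \<epsilon> where \<epsilon>: "0 < \<epsilon>" and no: "\<And>\<beta>. gauge \<beta> \<Longrightarrow>
        \<exists>P Q. P tagged_division_of cbox c d \<and> \<beta> fine P \<and> Q tagged_division_of cbox c d \<and> \<beta> fine Q \<and>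
          \<epsilon> \<le> step_dist (\<lambda>s. f (t, s)) P (\<lambda>s. f (t, s)) Q"
      unfolding step_Cauchy_on_def by (meson not_le)
    obtain n where "inverse (real (Suc n)) < \<epsilon>"
      using reals_Archimedean[OF \<epsilon>] by blast
    then have "t \<in> E (inverse (real (Suc n)))"
      unfolding E_def using t(1) no by (fastforce intro: order_trans[OF less_imp_le])
    then show "t \<in> (\<Union>n. E (inverse (real (Suc n))))" by blast
  qed
  ultimately show ?thesis by (rule negligible_subset)
qed

section \<open>Iterated integrals\<close>

lemma riemann_sum_diff_le:
  fixes u :: "'a::euclidean_space \<Rightarrow> 'x::real_normed_vector"
  assumes "D tagged_division_of cbox a b" and "\<And>t I. (t, I) \<in> D \<Longrightarrow> norm (u t - v t) \<le> e"
  shows "norm ((\<Sum>(t, I)\<in>D. content I *\<^sub>R u t) - (\<Sum>(t, I)\<in>D. content I *\<^sub>R v t)) \<le> e * content (cbox a b)"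
proof -
  have "norm ((\<Sum>(t, I)\<in>D. content I *\<^sub>R u t) - (\<Sum>(t, I)\<in>D. content I *\<^sub>R v t))
      = norm (\<Sum>(t, I)\<in>D. content I *\<^sub>R (u t - v t))"
    by (simp add: case_prod_unfold sum_subtractf scaleR_diff_right)
  also have "\<dots> \<le> (\<Sum>(t, I)\<in>D. e * content I)"
    using assms(2) by (intro sum_norm_le) (auto simp: mult.commute[of e] intro!: mult_left_mono)
  also have "\<dots> = e * content (cbox a b)"
    using additive_content_tagged_division[OF assms(1)] by (simp add: case_prod_unfold flip: sum_distrib_left)
  finally show ?thesis .
qed

text \<open>
  With divisions \<open>Q t\<close> whose Riemann sums are within \<open>\<eta>\<close> of \<open>g t\<close>, the difference \<open>g t - g t'\<close> is at most
  \<open>2 * \<eta>\<close> plus the distance of the slices at \<open>t\<close> and \<open>t'\<close> along \<open>Q t\<close> and \<open>Q t'\<close>. Weighted with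
  \<open>content (I \<inter> I')\<close> and summed, the latter is the distance of two fine product divisions for \<open>f\<close>. The
  same products compare the Riemann sums of \<open>g\<close> and \<open>f\<close>, which identifies the integrals.
\<close>

lemma Fubini_step_Cauchy_on:
  fixes f :: "'a::euclidean_space \<times> 'b::euclidean_space \<Rightarrow> 'x::banach"
  assumes f: "step_Cauchy_on (cbox (a, c) (b, d)) f"
    and slices: "\<And>t. t \<in> cbox a b \<Longrightarrow> (\<lambda>s. f (t, s)) integrable_on cbox c d"
  defines "g \<equiv> \<lambda>t. integral (cbox c d) (\<lambda>s. f (t, s))"
  shows "step_Cauchy_on (cbox a b) g"
    and "integral (cbox a b) g = integral (cbox (a, c) (b, d)) f"
proof -
  define C where "C = content (cbox a b)"
  have C0: "0 \<le> C" by (simp add: C_def)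
  have key: "\<exists>\<alpha> Q. gauge \<alpha> \<and> (\<forall>t. Q t tagged_division_of cbox c d) \<and>
      (\<forall>t\<in>cbox a b. norm (g t - (\<Sum>(s, J)\<in>Q t. content J *\<^sub>R f (t, s))) \<le> \<eta>) \<and>
      (\<forall>D. \<alpha> fine D \<longrightarrow> \<gamma> fine product_division D Q)"
    if \<gamma>: "gauge \<gamma>" and "0 < \<eta>" for \<gamma> :: "'a \<times> 'b \<Rightarrow> ('a \<times> 'b) set" and \<eta>
  proof -
    obtain \<beta> where \<beta>: "\<And>t. gauge (\<beta> t)"
      and \<alpha>: "\<And>Q. (\<And>t. finite (Q t)) \<Longrightarrow> (\<And>t. \<beta> t fine Q t) \<Longrightarrow>
           \<exists>\<alpha>. gauge \<alpha> \<and> (\<forall>D. \<alpha> fine D \<longrightarrow> \<gamma> fine product_division D Q)"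
      using gauge_slices[OF \<gamma>] by auto
    have "\<exists>Q. Q tagged_division_of cbox c d \<and> \<beta> t fine Q \<and>
        (t \<in> cbox a b \<longrightarrow> norm (g t - (\<Sum>(s, J)\<in>Q. content J *\<^sub>R f (t, s))) \<le> \<eta>)" for t
    proof (cases "t \<in> cbox a b")
      case True
      then have "((\<lambda>s. f (t, s)) has_integral g t) (cbox c d)"
        unfolding g_def by (intro integrable_integral slices)
      then obtain \<gamma>' where "gauge \<gamma>'" and \<gamma>': "\<And>Q. Q tagged_division_of cbox c d \<Longrightarrow> \<gamma>' fine Q \<Longrightarrow>
          norm ((\<Sum>(s, J)\<in>Q. content J *\<^sub>R f (t, s)) - g t) < \<eta>"
        using \<open>0 < \<eta>\<close> by (rule has_integralD) blast
      then obtain Q where "Q tagged_division_of cbox c d" "(\<lambda>x. \<beta> t x \<inter> \<gamma>' x) fine Q"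
        by (blast intro: fine_division_exists[OF gauge_Int[OF \<beta>]])
      then show ?thesis
        using \<gamma>'[of Q] by (intro exI[of _ Q]) (simp add: fine_Int norm_minus_commute)
    next
      case False
      obtain P where "P tagged_division_of cbox c d" "\<beta> t fine P"
        by (rule fine_division_exists[OF \<beta>])
      with False show ?thesis by blast
    qed
    then obtain Q where Q: "\<And>t. Q t tagged_division_of cbox c d" "\<And>t. \<beta> t fine Q t"
      "\<And>t. t \<in> cbox a b \<Longrightarrow> norm (g t - (\<Sum>(s, J)\<in>Q t. content J *\<^sub>R f (t, s))) \<le> \<eta>"
      by metis
    moreover obtain \<alpha> where "gauge \<alpha>" "\<And>D. \<alpha> fine D \<Longrightarrow> \<gamma> fine product_division D Q"
      using \<alpha>[OF tagged_division_of_finite[OF Q(1)] Q(2)] by auto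
    ultimately show ?thesis
      by (intro exI[of _ \<alpha>] exI[of _ Q]) simp
  qed
  show g: "step_Cauchy_on (cbox a b) g"
    unfolding step_Cauchy_on_def
  proof (intro allI impI)
    fix \<epsilon> :: real assume "0 < \<epsilon>"
    then have \<epsilon>2: "0 < \<epsilon> / 2" by simp
    \<comment> \<open>The summand \<open>1\<close> guards against a degenerate interval, where \<open>C = 0\<close>.\<close>
    define \<eta> where "\<eta> = \<epsilon> / (4 * (C + 1))"
    have \<eta>: "0 < \<eta>" "2 * \<eta> * C \<le> \<epsilon> / 2"
      using \<open>0 < \<epsilon>\<close> C0 by (auto simp: \<eta>_def field_simps)
    obtain \<gamma> where \<gamma>: "gauge \<gamma>"
      and lt: "\<And>P Q. P tagged_division_of cbox (a, c) (b, d) \<Longrightarrow> \<gamma> fine P \<Longrightarrow>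
        Q tagged_division_of cbox (a, c) (b, d) \<Longrightarrow> \<gamma> fine Q \<Longrightarrow> step_dist f P f Q < \<epsilon> / 2"
      using f \<epsilon>2 by (rule step_Cauchy_onE) blast
    obtain \<alpha> Q where \<alpha>: "gauge \<alpha>" and Q: "\<And>t. Q t tagged_division_of cbox c d"
      and approx: "\<And>t. t \<in> cbox a b \<Longrightarrow> norm (g t - (\<Sum>(s, J)\<in>Q t. content J *\<^sub>R f (t, s))) \<le> \<eta>"
      and fine: "\<And>D. \<alpha> fine D \<Longrightarrow> \<gamma> fine product_division D Q"
      using key[OF \<gamma> \<eta>(1)] by metis
    have "step_dist g D g D' < \<epsilon>"
      if D: "D tagged_division_of cbox a b" "\<alpha> fine D"
        and D': "D' tagged_division_of cbox a b" "\<alpha> fine D'" for D D'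
    proof -
      let ?s = "\<lambda>t t'. step_dist (\<lambda>s. f (t, s)) (Q t) (\<lambda>s. f (t', s)) (Q t')"
      have "step_dist g D g D' \<le> (\<Sum>(t, I)\<in>D. \<Sum>(t', I')\<in>D'. 2 * \<eta> * content (I \<inter> I') + content (I \<inter> I') * ?s t t')"
        unfolding step_dist_def[of g]
      proof (intro sum_mono, clarify, intro sum_mono, clarify)
        fix t I t' I' assume "(t, I) \<in> D" "(t', I') \<in> D'"
        then have t: "t \<in> cbox a b" "t' \<in> cbox a b"
          using tag_in_interval D(1) D'(1) by blast+
        define S where "S t = (\<Sum>(s, J)\<in>Q t. content J *\<^sub>R f (t, s))" for t
        have "norm (S t - S t') \<le> ?s t t'"
          unfolding S_def using Q by (intro riemann_sum_diff_le_step_dist)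
        moreover have "norm (g t - S t) \<le> \<eta>" "norm (g t' - S t') \<le> \<eta>"
          using approx t by (auto simp: S_def)
        moreover have "norm (g t - g t') \<le> norm (g t - S t) + norm (S t - S t') + norm (g t' - S t')"
          using norm_triangle_ineq4[of "g t - S t + (S t - S t')" "g t' - S t'"]
            norm_triangle_ineq[of "g t - S t" "S t - S t'"] by simp
        ultimately have "norm (g t - g t') \<le> 2 * \<eta> + ?s t t'" by linarith
        then have "norm (g t - g t') * content (I \<inter> I') \<le> (2 * \<eta> + ?s t t') * content (I \<inter> I')"
          by (rule mult_right_mono) simp
        then show "norm (g t - g t') * content (I \<inter> I') \<le> 2 * \<eta> * content (I \<inter> I') + content (I \<inter> I') * ?s t t'"
          by (simp add: algebra_simps)
      qed
      also have "\<dots> = 2 * \<eta> * (\<Sum>(t, I)\<in>D. \<Sum>(t', I')\<in>D'. content (I \<inter> I'))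
          + (\<Sum>(t, I)\<in>D. \<Sum>(t', I')\<in>D'. content (I \<inter> I') * ?s t t')"
        by (simp add: case_prod_unfold sum.distrib sum_distrib_left)
      also have "(\<Sum>(t, I)\<in>D. \<Sum>(t', I')\<in>D'. content (I \<inter> I')) = (\<Sum>(t, I)\<in>D. content I)"
        using riemann_sum_common_refinement(1)[OF D(1) D'(1), of "\<lambda>_. 1 :: real"] by simp
      also have "\<dots> = C"
        unfolding C_def by (rule additive_content_tagged_division[OF D(1)])
      also have "(\<Sum>(t, I)\<in>D. \<Sum>(t', I')\<in>D'. content (I \<inter> I') * ?s t t')
          = step_dist f (product_division D Q) f (product_division D' Q)"
        by (rule step_dist_product_division[OF D(1) Q D'(1) Q, symmetric])
      also have "2 * \<eta> * C + \<dots> < \<epsilon> / 2 + \<epsilon> / 2"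
        using \<eta>(2) D D' by (intro add_le_less_mono lt product_division_tagged_division_of Q fine)
      finally show ?thesis by simp
    qed
    then show "\<exists>\<alpha>. gauge \<alpha> \<and> (\<forall>D D'. D tagged_division_of cbox a b \<and> \<alpha> fine D \<and>
        D' tagged_division_of cbox a b \<and> \<alpha> fine D' \<longrightarrow> step_dist g D g D' < \<epsilon>)"
      using \<alpha> by (intro exI[of _ \<alpha>]) simp
  qed
  let ?G = "integral (cbox a b) g" and ?F = "integral (cbox (a, c) (b, d)) f"
  have "norm (?G - ?F) \<le> \<epsilon>" if "0 < \<epsilon>" for \<epsilon>
  proof -
    have \<epsilon>3: "0 < \<epsilon> / 3" using that by simp
    define \<eta> where "\<eta> = \<epsilon> / (3 * (C + 1))"
    have \<eta>: "0 < \<eta>" "\<eta> * C \<le> \<epsilon> / 3"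
      using \<open>0 < \<epsilon>\<close> C0 by (auto simp: \<eta>_def field_simps)
    have "(f has_integral ?F) (cbox (a, c) (b, d))"
      using step_Cauchy_on_imp_integrable[OF f] by (rule integrable_integral)
    then obtain \<gamma> where \<gamma>: "gauge \<gamma>"
      and F: "\<And>P. P tagged_division_of cbox (a, c) (b, d) \<Longrightarrow> \<gamma> fine P \<Longrightarrow>
        norm ((\<Sum>(z, R)\<in>P. content R *\<^sub>R f z) - ?F) < \<epsilon> / 3"
      using \<epsilon>3 by (rule has_integralD) blast
    have "(g has_integral ?G) (cbox a b)"
      using step_Cauchy_on_imp_integrable[OF g] by (rule integrable_integral)
    then obtain \<alpha>' where \<alpha>': "gauge \<alpha>'"
      and G: "\<And>D. D tagged_division_of cbox a b \<Longrightarrow> \<alpha>' fine D \<Longrightarrow>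
        norm ((\<Sum>(t, I)\<in>D. content I *\<^sub>R g t) - ?G) < \<epsilon> / 3"
      using \<epsilon>3 by (rule has_integralD) blast
    obtain \<alpha> Q where \<alpha>: "gauge \<alpha>" and Q: "\<And>t. Q t tagged_division_of cbox c d"
      and approx: "\<And>t. t \<in> cbox a b \<Longrightarrow> norm (g t - (\<Sum>(s, J)\<in>Q t. content J *\<^sub>R f (t, s))) \<le> \<eta>"
      and fine: "\<And>D. \<alpha> fine D \<Longrightarrow> \<gamma> fine product_division D Q"
      using key[OF \<gamma> \<eta>(1)] by metis
    obtain D where D: "D tagged_division_of cbox a b" "(\<lambda>x. \<alpha> x \<inter> \<alpha>' x) fine D"
      by (rule fine_division_exists[OF gauge_Int[OF \<alpha> \<alpha>']])
    define S where "S t = (\<Sum>(s, J)\<in>Q t. content J *\<^sub>R f (t, s))" for t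
    have "(\<Sum>(z, R)\<in>product_division D Q. content R *\<^sub>R f z) = (\<Sum>(t, I)\<in>D. \<Sum>(s, J)\<in>Q t. content (I \<times> J) *\<^sub>R f (t, s))"
      by (rule sum_product_division[OF D(1) Q])
    also have "\<dots> = (\<Sum>(t, I)\<in>D. content I *\<^sub>R S t)"
      unfolding S_def
    proof (intro sum.cong refl, clarify)
      fix t I assume tI: "(t, I) \<in> D"
      have "content (I \<times> J) = content I * content J" if sJ: "(s, J) \<in> Q t" for s J
      proof -
        obtain x y x' y' where "I = cbox x y" "J = cbox x' y'"
          using tagged_division_ofD(4)[OF D(1) tI] tagged_division_ofD(4)[OF Q sJ] by blast
        then show ?thesis by (simp add: content_Pair flip: cbox_Pair_eq)
      qed
      then show "(\<Sum>(s, J)\<in>Q t. content (I \<times> J) *\<^sub>R f (t, s)) = content I *\<^sub>R (\<Sum>(s, J)\<in>Q t. content J *\<^sub>R f (t, s))"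
        unfolding scaleR_right.sum by (intro sum.cong refl) auto
    qed
    finally have prod: "(\<Sum>(z, R)\<in>product_division D Q. content R *\<^sub>R f z) = (\<Sum>(t, I)\<in>D. content I *\<^sub>R S t)" .
    have "norm ((\<Sum>(t, I)\<in>D. content I *\<^sub>R S t) - ?F) < \<epsilon> / 3"
      unfolding prod[symmetric] using D fine
      by (intro F product_division_tagged_division_of Q) (auto simp: fine_Int)
    moreover have "norm ((\<Sum>(t, I)\<in>D. content I *\<^sub>R g t) - ?G) < \<epsilon> / 3"
      using D by (intro G) (auto simp: fine_Int)
    moreover have "norm ((\<Sum>(t, I)\<in>D. content I *\<^sub>R g t) - (\<Sum>(t, I)\<in>D. content I *\<^sub>R S t)) \<le> \<eta> * C"
      unfolding C_def using D(1) approx tag_in_interval[OF D(1)]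
      by (intro riemann_sum_diff_le) (auto simp: S_def)
    ultimately show ?thesis
      using \<eta>(2)
        norm_triangle_ineq4[of "(\<Sum>(t, I)\<in>D. content I *\<^sub>R g t) - (\<Sum>(t, I)\<in>D. content I *\<^sub>R S t)
            + ((\<Sum>(t, I)\<in>D. content I *\<^sub>R S t) - ?F)" "(\<Sum>(t, I)\<in>D. content I *\<^sub>R g t) - ?G"]
        norm_triangle_ineq[of "(\<Sum>(t, I)\<in>D. content I *\<^sub>R g t) - (\<Sum>(t, I)\<in>D. content I *\<^sub>R S t)"
            "(\<Sum>(t, I)\<in>D. content I *\<^sub>R S t) - ?F"] by simp
  qed
  then have "norm (?G - ?F) \<le> 0"
    by (intro field_le_epsilon[of _ 0]) simp
  then show "?G = ?F" by simp
qed

section \<open>Null sets in products and exchange of coordinates\<close>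

text \<open>
  The null set may be assumed Borel, and then the product measure of its cylinder is \<open>0 \<cdot> \<infinity> = 0\<close>.
\<close>

lemma negligible_Times:
  fixes N :: "'a::euclidean_space set" and S :: "'b::euclidean_space set"
  assumes "negligible N"
  shows "negligible (N \<times> S)" and "negligible (S \<times> N)"
proof -
  obtain N' where N': "N' \<in> null_sets lborel" "N \<subseteq> N'"
    using assms unfolding negligible_iff_null_sets null_sets_completion_iff2 by blast
  have "N' \<times> (UNIV :: 'b set) \<in> null_sets (lborel \<Otimes>\<^sub>M lborel)"
       "(UNIV :: 'b set) \<times> N' \<in> null_sets (lborel \<Otimes>\<^sub>M lborel)"
    using N'(1) by (auto simp: null_sets_def lborel.emeasure_pair_measure_Times)
  then have "negligible (N' \<times> (UNIV :: 'b set))" "negligible ((UNIV :: 'b set) \<times> N')"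
    unfolding lborel_prod by (auto simp: negligible_iff_null_sets intro: null_sets_completionI)
  then show "negligible (N \<times> S)" "negligible (S \<times> N)"
    using N'(2) by (auto elim!: negligible_subset)
qed

definition swap_division :: "(('a \<times> 'b) \<times> ('a \<times> 'b) set) set \<Rightarrow> (('b \<times> 'a) \<times> ('b \<times> 'a) set) set" where
  "swap_division P = (\<lambda>(z, R). (prod.swap z, prod.swap ` R)) ` P"

lemma swap_cbox:
  fixes R :: "('a::euclidean_space \<times> 'b::euclidean_space) set"
  assumes "R = cbox x y"
  shows "\<exists>u v. prod.swap ` R = cbox u v"
    and "content (prod.swap ` R) = content R"
    and "interior (prod.swap ` R) = prod.swap ` interior R"
proof -
  obtain x1 x2 y1 y2 where xy: "x = (x1, x2)" "y = (y1, y2)" by fastforce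
  have eq: "prod.swap ` R = cbox (x2, x1) (y2, y1)"
    unfolding assms xy by simp
  then show "\<exists>u v. prod.swap ` R = cbox u v" by blast
  show "content (prod.swap ` R) = content R"
    unfolding eq unfolding assms xy content_Pair by simp
  show "interior (prod.swap ` R) = prod.swap ` interior R"
    unfolding eq unfolding assms xy cbox_Pair_eq interior_Times product_swap ..
qed

lemma swap_division_tagged_division_of:
  fixes K :: "('a::euclidean_space \<times> 'b::euclidean_space) set"
  assumes P: "P tagged_division_of K"
  shows "swap_division P tagged_division_of prod.swap ` K"
proof (rule tagged_division_ofI)
  note PD = tagged_division_ofD[OF P]
  show "finite (swap_division P)"
    using PD(1) by (simp add: swap_division_def)
  show "z \<in> R" if "(z, R) \<in> swap_division P" for z R
    using that PD(2) by (auto simp: swap_division_def)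
  show "R \<subseteq> prod.swap ` K" if "(z, R) \<in> swap_division P" for z R
    using that PD(3) by (fastforce simp: swap_division_def)
  show "\<exists>x y. R = cbox x y" if "(z, R) \<in> swap_division P" for z R
  proof -
    obtain w S where "R = prod.swap ` S" "(w, S) \<in> P"
      using \<open>(z, R) \<in> _\<close> by (auto simp: swap_division_def)
    then show ?thesis using PD(4) swap_cbox(1) by metis
  qed
  show "interior R1 \<inter> interior R2 = {}"
    if z: "(z1, R1) \<in> swap_division P" "(z2, R2) \<in> swap_division P" "(z1, R1) \<noteq> (z2, R2)"
    for z1 R1 z2 R2
  proof -
    obtain w1 S1 where 1: "z1 = prod.swap w1" "R1 = prod.swap ` S1" "(w1, S1) \<in> P"
      using z(1) by (auto simp: swap_division_def)
    obtain w2 S2 where 2: "z2 = prod.swap w2" "R2 = prod.swap ` S2" "(w2, S2) \<in> P"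
      using z(2) by (auto simp: swap_division_def)
    have "interior S1 \<inter> interior S2 = {}"
      using PD(5)[OF 1(3) 2(3)] z(3) 1 2 by blast
    moreover have "interior R1 = prod.swap ` interior S1" "interior R2 = prod.swap ` interior S2"
      using 1 2 PD(4) swap_cbox(3) by blast+
    ultimately show ?thesis by (auto simp: image_iff)
  qed
  have "\<Union>{R. \<exists>z. (z, R) \<in> swap_division P} = prod.swap ` \<Union>{R. \<exists>z. (z, R) \<in> P}"
    by (force simp: swap_division_def image_Union)
  then show "\<Union>{R. \<exists>z. (z, R) \<in> swap_division P} = prod.swap ` K"
    unfolding PD(6) .
qed

lemma step_dist_swap_division:
  fixes f :: "'a::euclidean_space \<times> 'b::euclidean_space \<Rightarrow> 'x::real_normed_vector"
  assumes P: "P tagged_division_of K" and Q: "Q tagged_division_of K"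
  shows "step_dist (\<lambda>z. f (prod.swap z)) (swap_division P) (\<lambda>z. f (prod.swap z)) (swap_division Q)
    = step_dist f P f Q"
proof -
  have inj: "inj_on (\<lambda>(z, R). (prod.swap z, prod.swap ` R)) S" for S :: "(('a \<times> 'b) \<times> ('a \<times> 'b) set) set"
    by (auto simp: inj_on_def inj_image_eq_iff[OF inj_swap])
  have "content (prod.swap ` I \<inter> prod.swap ` J) = content (I \<inter> J)"
    if I: "(t, I) \<in> P" and J: "(s, J) \<in> Q" for t I s J
  proof -
    obtain x y x' y' where "I = cbox x y" "J = cbox x' y'"
      using tagged_division_ofD(4)[OF P I] tagged_division_ofD(4)[OF Q J] by blast
    then obtain u v where "I \<inter> J = cbox u v" by (simp add: Int_interval)
    then show ?thesis
      using swap_cbox(2) image_Int[OF inj_swap] by metis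
  qed
  then show ?thesis
    unfolding step_dist_def swap_division_def sum.reindex[OF inj]
    by (auto simp: case_prod_unfold sum.reindex[OF inj[unfolded case_prod_unfold]] intro!: sum.cong)
qed

lemma step_Cauchy_on_swap:
  fixes f :: "'a::euclidean_space \<times> 'b::euclidean_space \<Rightarrow> 'x::real_normed_vector"
  assumes f: "step_Cauchy_on K f"
  shows "step_Cauchy_on (prod.swap ` K) (\<lambda>z. f (prod.swap z))"
  unfolding step_Cauchy_on_def
proof (intro allI impI)
  fix \<epsilon> :: real assume "0 < \<epsilon>"
  with f obtain \<gamma> where \<gamma>: "gauge \<gamma>"
    and lt: "\<And>P Q. P tagged_division_of K \<Longrightarrow> \<gamma> fine P \<Longrightarrow> Q tagged_division_of K
      \<Longrightarrow> \<gamma> fine Q \<Longrightarrow> step_dist f P f Q < \<epsilon>"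
    by (rule step_Cauchy_onE) blast
  define \<gamma>' where "\<gamma>' z = prod.swap -` \<gamma> (prod.swap z)" for z
  have "gauge \<gamma>'"
    unfolding gauge_def \<gamma>'_def
    using gaugeD[OF \<gamma>] by (auto intro!: open_vimage continuous_on_swap)
  moreover have "step_dist (\<lambda>z. f (prod.swap z)) P (\<lambda>z. f (prod.swap z)) Q < \<epsilon>"
    if P: "P tagged_division_of prod.swap ` K" "\<gamma>' fine P"
      and Q: "Q tagged_division_of prod.swap ` K" "\<gamma>' fine Q" for P Q
  proof -
    have involution: "swap_division (swap_division R) = R" for R :: "(('c \<times> 'd) \<times> ('c \<times> 'd) set) set"
      by (force simp: swap_division_def image_image)
    have tag: "swap_division R tagged_division_of K" if "R tagged_division_of prod.swap ` K" for R
      using swap_division_tagged_division_of[OF that] by (simp add: image_image)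
    have fine: "\<gamma> fine swap_division R" if "\<gamma>' fine R" for R
      using that unfolding fine_def swap_division_def \<gamma>'_def by fastforce
    have "step_dist (\<lambda>z. f (prod.swap z)) P (\<lambda>z. f (prod.swap z)) Q
        = step_dist f (swap_division P) f (swap_division Q)"
      using step_dist_swap_division[OF tag[OF P(1)] tag[OF Q(1)], of f] by (simp add: involution)
    also have "\<dots> < \<epsilon>"
      using P Q by (intro lt tag fine)
    finally show ?thesis .
  qed
  ultimately show "\<exists>\<gamma>. gauge \<gamma> \<and> (\<forall>P Q. P tagged_division_of prod.swap ` K \<and> \<gamma> fine P \<and>
      Q tagged_division_of prod.swap ` K \<and> \<gamma> fine Q \<longrightarrow>
      step_dist (\<lambda>z. f (prod.swap z)) P (\<lambda>z. f (prod.swap z)) Q < \<epsilon>)"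
    by (intro exI[of _ \<gamma>']) simp
qed

lemma integral_swap_cbox:
  fixes f :: "'a::euclidean_space \<times> 'b::euclidean_space \<Rightarrow> 'x::banach"
  assumes f: "f integrable_on cbox (a, c) (b, d)"
  shows "integral (cbox (c, a) (d, b)) (\<lambda>z. f (prod.swap z)) = integral (cbox (a, c) (b, d)) f"
proof -
  have "((\<lambda>z. f (prod.swap z)) has_integral integral (cbox (a, c) (b, d)) f) (prod.swap ` cbox (a, c) (b, d))"
  proof (rule has_integral_twiddle[of 1 prod.swap prod.swap f "integral (cbox (a, c) (b, d)) f", simplified div_by_1 scaleR_one])
    show "\<exists>w z. prod.swap ` cbox u v = cbox w z" for u v :: "'b \<times> 'a"
      by (rule swap_cbox(1)[OF refl])
    show "\<exists>w z. prod.swap ` cbox u v = cbox w z" for u v :: "'a \<times> 'b"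
      by (rule swap_cbox(1)[OF refl])
    show "content (prod.swap ` cbox u v) = 1 * content (cbox u v)" for u v :: "'b \<times> 'a"
      using swap_cbox(2)[OF refl, of u v] by simp
  qed (use isCont_swap integrable_integral[OF f] in auto)
  then show ?thesis
    by (simp add: integral_unique)
qed

section \<open>The Fubini theorem\<close>

theorem theorem2p5:
  fixes f f\<^sub>0 :: "real \<times> real \<Rightarrow> 'x::banach"
    and a\<^sub>1 b\<^sub>1 a\<^sub>2 b\<^sub>2 :: real
    and Z\<^sub>1 Z\<^sub>2 :: "real set" and Z :: "(real \<times> real) set"
  assumes "a\<^sub>1 < b\<^sub>1" and "a\<^sub>2 < b\<^sub>2"
    and "f \<in> Sstar_HK ({a\<^sub>1..b\<^sub>1} \<times> {a\<^sub>2..b\<^sub>2})"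
    and "Z\<^sub>1 = {t\<^sub>1 \<in> {a\<^sub>1..b\<^sub>1}. (\<lambda>s\<^sub>2. f (t\<^sub>1, s\<^sub>2)) \<notin> Sstar_HK {a\<^sub>2..b\<^sub>2}}"
    and "Z\<^sub>2 = {t\<^sub>2 \<in> {a\<^sub>2..b\<^sub>2}. (\<lambda>s\<^sub>1. f (s\<^sub>1, t\<^sub>2)) \<notin> Sstar_HK {a\<^sub>1..b\<^sub>1}}"
    and "Z = (Z\<^sub>1 \<times> {a\<^sub>2..b\<^sub>2}) \<union> ({a\<^sub>1..b\<^sub>1} \<times> Z\<^sub>2)"
    and "f\<^sub>0 = (\<lambda>t. indicator ({a\<^sub>1..b\<^sub>1} \<times> {a\<^sub>2..b\<^sub>2} - Z) t *\<^sub>R f t)"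
  shows
    "(f\<^sub>0 \<in> SHK ({a\<^sub>1..b\<^sub>1} \<times> {a\<^sub>2..b\<^sub>2}) \<and>
      (\<forall>t\<^sub>1\<in>{a\<^sub>1..b\<^sub>1}. \<forall>t\<^sub>2\<in>{a\<^sub>2..b\<^sub>2}.
         (\<lambda>s\<^sub>2. f\<^sub>0 (t\<^sub>1, s\<^sub>2)) \<in> SHK {a\<^sub>2..b\<^sub>2} \<and> (\<lambda>s\<^sub>1. f\<^sub>0 (s\<^sub>1, t\<^sub>2)) \<in> SHK {a\<^sub>1..b\<^sub>1})) \<and>
     ((\<lambda>t\<^sub>1. integral {a\<^sub>2..b\<^sub>2} (\<lambda>s\<^sub>2. f\<^sub>0 (t\<^sub>1, s\<^sub>2))) \<in> SHK {a\<^sub>1..b\<^sub>1} \<and>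
      integral {a\<^sub>1..b\<^sub>1} (\<lambda>t\<^sub>1. integral {a\<^sub>2..b\<^sub>2} (\<lambda>s\<^sub>2. f\<^sub>0 (t\<^sub>1, s\<^sub>2)))
        = integral ({a\<^sub>1..b\<^sub>1} \<times> {a\<^sub>2..b\<^sub>2}) f) \<and>
     ((\<lambda>t\<^sub>2. integral {a\<^sub>1..b\<^sub>1} (\<lambda>s\<^sub>1. f\<^sub>0 (s\<^sub>1, t\<^sub>2))) \<in> SHK {a\<^sub>2..b\<^sub>2} \<and>
      integral {a\<^sub>2..b\<^sub>2} (\<lambda>t\<^sub>2. integral {a\<^sub>1..b\<^sub>1} (\<lambda>s\<^sub>1. f\<^sub>0 (s\<^sub>1, t\<^sub>2)))
        = integral ({a\<^sub>1..b\<^sub>1} \<times> {a\<^sub>2..b\<^sub>2}) f)"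
proof -
  let ?K = "cbox (a\<^sub>1, a\<^sub>2) (b\<^sub>1, b\<^sub>2)"
  let ?K' = "cbox (a\<^sub>2, a\<^sub>1) (b\<^sub>2, b\<^sub>1)"
  have K: "{a\<^sub>1..b\<^sub>1} \<times> {a\<^sub>2..b\<^sub>2} = ?K"
    by (simp add: cbox_Pair_eq)
  have ne: "interior (cbox a\<^sub>1 b\<^sub>1) \<noteq> {}" "interior (cbox a\<^sub>2 b\<^sub>2) \<noteq> {}" "interior ?K \<noteq> {}"
    using assms(1,2) by (simp_all add: cbox_Pair_eq interior_Times)
  have f: "step_Cauchy_on ?K f"
    using assms(3) unfolding K Sstar_HK_iff_step_Cauchy_on[OF ne(3)] .
  have fs: "step_Cauchy_on ?K' (\<lambda>z. f (prod.swap z))"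
    using step_Cauchy_on_swap[OF f] by simp
  have Z1: "Z\<^sub>1 = {t \<in> cbox a\<^sub>1 b\<^sub>1. \<not> step_Cauchy_on (cbox a\<^sub>2 b\<^sub>2) (\<lambda>s. f (t, s))}"
    and Z2: "Z\<^sub>2 = {t \<in> cbox a\<^sub>2 b\<^sub>2. \<not> step_Cauchy_on (cbox a\<^sub>1 b\<^sub>1) (\<lambda>s. f (s, t))}"
    unfolding assms(4,5) by (simp_all add: Sstar_HK_iff_step_Cauchy_on[OF ne(1)] Sstar_HK_iff_step_Cauchy_on[OF ne(2)] flip: box_real)
  have N1: "negligible Z\<^sub>1"
    unfolding Z1 by (rule negligible_non_step_Cauchy_slices[OF f])
  have N2: "negligible Z\<^sub>2"
    unfolding Z2 using negligible_non_step_Cauchy_slices[OF fs] by simp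
  have NZ: "negligible Z"
    unfolding assms(6) by (intro negligible_Un negligible_Times N1 N2)
  have zero: "step_Cauchy_on (cbox c d) (\<lambda>_. 0 :: 'x)" for c d :: real
    unfolding step_Cauchy_on_def step_dist_def by (auto intro!: exI[of _ "\<lambda>x. ball x 1"])
  have f0: "step_Cauchy_on ?K f\<^sub>0"
    by (rule step_Cauchy_on_spike[OF f NZ]) (simp add: assms(7) K)
  have slice1: "step_Cauchy_on (cbox a\<^sub>2 b\<^sub>2) (\<lambda>s. f\<^sub>0 (t, s))" if "t \<in> cbox a\<^sub>1 b\<^sub>1" for t
  proof (cases "t \<in> Z\<^sub>1")
    case True
    show ?thesis
      by (rule step_Cauchy_on_spike[OF zero negligible_empty]) (use True in \<open>auto simp: assms(6,7)\<close>)
  next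
    case False
    with that have "step_Cauchy_on (cbox a\<^sub>2 b\<^sub>2) (\<lambda>s. f (t, s))" by (simp add: Z1)
    then show ?thesis
      by (rule step_Cauchy_on_spike[OF _ N2]) (use False that in \<open>auto simp: assms(6,7)\<close>)
  qed
  have slice2: "step_Cauchy_on (cbox a\<^sub>1 b\<^sub>1) (\<lambda>s. f\<^sub>0 (s, t))" if "t \<in> cbox a\<^sub>2 b\<^sub>2" for t
  proof (cases "t \<in> Z\<^sub>2")
    case True
    show ?thesis
      by (rule step_Cauchy_on_spike[OF zero negligible_empty]) (use True in \<open>auto simp: assms(6,7)\<close>)
  next
    case False
    with that have "step_Cauchy_on (cbox a\<^sub>1 b\<^sub>1) (\<lambda>s. f (s, t))" by (simp add: Z2)
    then show ?thesis
      by (rule step_Cauchy_on_spike[OF _ N1]) (use False that in \<open>auto simp: assms(6,7)\<close>)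
  qed
  have int: "integral ?K f\<^sub>0 = integral ?K f"
    by (rule integral_spike[OF NZ]) (simp add: assms(7) K)
  \<comment> \<open>Every slice of \<open>f\<^sub>0\<close> is integrable, so no exceptional points remain in the iterated integrals.\<close>
  note fub1 = Fubini_step_Cauchy_on[OF f0 step_Cauchy_on_imp_integrable[OF slice1]]
  have f0s: "step_Cauchy_on ?K' (\<lambda>z. f\<^sub>0 (prod.swap z))"
    using step_Cauchy_on_swap[OF f0] by simp
  have "(\<lambda>s. f\<^sub>0 (prod.swap (t, s))) integrable_on cbox a\<^sub>1 b\<^sub>1" if "t \<in> cbox a\<^sub>2 b\<^sub>2" for t
    using step_Cauchy_on_imp_integrable[OF slice2[OF that]] by simp
  note fub2 = Fubini_step_Cauchy_on[OF f0s this]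
  have ints: "integral ?K' (\<lambda>z. f\<^sub>0 (prod.swap z)) = integral ?K f\<^sub>0"
    by (rule integral_swap_cbox[OF step_Cauchy_on_imp_integrable[OF f0]])
  show ?thesis
    using step_Cauchy_on_imp_SHK[OF f0] step_Cauchy_on_imp_SHK[OF slice1] step_Cauchy_on_imp_SHK[OF slice2]
      step_Cauchy_on_imp_SHK[OF fub1(1)] fub1(2) step_Cauchy_on_imp_SHK[OF fub2(1)] fub2(2)
    unfolding K int ints by simp
qed

end
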